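(* With the operators $\hat R(s),\hat T(s),\hat U(s)$ on $L^1(\tilde Y)$ defined in the context, $$\hat T(s)\hat R(s)=\hat T(s)-\hat U(s)\qquad\text{for all } s\in\mathbb{H}=\{s\in\mathbb{C}:\operatorname{Re}s>0\}.$$
   Context: **Setting.** $(Y,\mu)$ is a Lebesgue probability space with countable measurable partition $\alpha$, and $F:Y\to Y$ is a full branch Gibbs-Markov map: ergodic, conservative, measure-preserving, mapping each $a\in\alpha$ bijectively onto $Y$, with $\alpha$ separating orbits, and with $g=\log\frac{d\mu}{d\mu\circ F}$ being $d_\theta$-Lipschitz on each $a\in\alpha$ with constant uniform in $a$, where $d_\theta(y,y')=\theta^{s(y,y')}$ for some $\theta\in(0,1)$ and $s(y,y')$ is the least $n\ge0$ such that $F^ny,F^ny'$ lie in distinct elements of $\alpha$. The roof function $\varphi:Y\to\mathbb{R}^+$ is measurable, with $\inf\varphi>2$, and is $d_{\theta_0}$-Lipschitz on each $a\in\alpha$ with Lipschitz constant at most $C_2\inf_a\varphi$ (for some $\theta_0\in(0,1)$, $C_2>0$). **Suspension.** $Y^\varphi=\{(y,u)\in Y\times\mathbb{R}:0\le u\le\varphi(y)\}/\sim$ with $(y,\varphi(y))\sim(Fy,0)$; $f_t(y,u)=(y,u+t)$ modulo identifications; $\mu^\varphi=\mu\times\mathrm{Lebesgue}$ (divided by $\bar\varphi=\int_Y\varphi\,d\mu$ if $\varphi$ is integrable). $\tilde Y=Y\times[0,1]\subset Y^\varphi$, $\tilde\mu=\mu\times\mathrm{Lebesgue}$ on $\tilde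 Y$, $\tilde F(y,u)=(Fy,u)$, $\tilde\varphi(y,u)=\varphi(y)$. **Operators.** $L_t:L^1(Y^\varphi)\to L^1(Y^\varphi)$ is the transfer operator of $f_t$: $\int L_tv\,w\,d\mu^\varphi=\int v\,w\circ f_t\,d\mu^\varphi$ for $w\in L^\infty$. $\tilde R:L^1(\tilde Y)\to L^1(\tilde Y)$ is the transfer operator of $\tilde F$: $\int\tilde Rv\,w\,d\tilde\mu=\int v\,w\circ\tilde F\,d\tilde\mu$. For $t>0$ define on $L^1(\tilde Y)$ (functions extended by zero to $Y^\varphi$): $T_tv=1_{\tilde Y}L_t(1_{\tilde Y}v)$, $U_tv=1_{\tilde Y}L_t(1_{\{\tilde\varphi>t\}}v)$. For $s\in\mathbb{H}$: $\hat R(s)v=\tilde R(e^{-s\tilde\varphi}v)$, $\hat T(s)v=\int_0^\infty e^{-st}T_tv\,dt$, $\hat U(s)v=\int_0^\infty e^{-st}U_tv\,dt$. *)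

theory Defs
  imports "HOL-Probability.Probability" "HOL-Library.Extended_Nat"
begin

section \<open>Lebesgue probability spaces\<close>

definition iso_mod_0 :: "'a measure \<Rightarrow> 'b measure \<Rightarrow> bool" where
  "iso_mod_0 M N \<longleftrightarrow> (\<exists>A\<in>null_sets M. \<exists>B\<in>null_sets N. \<exists>h k.
     let M' = restrict_space M (space M - A); N' = restrict_space N (space N - B) in
       h \<in> measurable M' N' \<and> k \<in> measurable N' M' \<and>
       (\<forall>x\<in>space M'. k (h x) = x) \<and> (\<forall>y\<in>space N'. h (k y) = y) \<and>
       distr M' N' h = N')"

text \<open>Lebesgue measure on the interval from \<open>0\<close> to \<open>c\<close> together with atoms of mass \<open>p n\<close>
  at the points \<open>c + 1 + n\<close>.\<close>

definition interval_with_atoms :: "real \<Rightarrow> (nat \<Rightarrow> real) \<Rightarrow> real measure" where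
  "interval_with_atoms c p = measure_of UNIV (sets borel)
     (\<lambda>B. emeasure lborel (B \<inter> {0..c}) + (\<Sum>n. ennreal (p n) * indicator B (c + 1 + real n)))"

text \<open>Both sides are completed, so that the definition covers Rokhlin's complete Lebesgue spaces
  as well as standard Borel probability spaces.\<close>

definition lebesgue_prob_space :: "'a measure \<Rightarrow> bool" where
  "lebesgue_prob_space M \<longleftrightarrow> prob_space M \<and>
     (\<exists>c p. 0 \<le> c \<and> (\<forall>n. 0 \<le> p n) \<and>
        iso_mod_0 (completion M) (completion (interval_with_atoms c p)))"


section \<open>Full branch Gibbs--Markov maps\<close>

definition sep_time :: "'a set set \<Rightarrow> ('a \<Rightarrow> 'a) \<Rightarrow> 'a \<Rightarrow> 'a \<Rightarrow> enat" where
  "sep_time \<alpha> F y y' =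
     Inf {enat n | n. \<exists>a\<in>\<alpha>. \<exists>b\<in>\<alpha>. a \<noteq> b \<and> (F ^^ n) y \<in> a \<and> (F ^^ n) y' \<in> b}"

definition d_sep :: "'a set set \<Rightarrow> ('a \<Rightarrow> 'a) \<Rightarrow> real \<Rightarrow> 'a \<Rightarrow> 'a \<Rightarrow> real" where
  "d_sep \<alpha> F \<theta> y y' = (case sep_time \<alpha> F y y' of enat n \<Rightarrow> \<theta> ^ n | \<infinity> \<Rightarrow> 0)"

definition ergodic_map :: "'a measure \<Rightarrow> ('a \<Rightarrow> 'a) \<Rightarrow> bool" where
  "ergodic_map M F \<longleftrightarrow>
     (\<forall>E\<in>sets M. F -` E \<inter> space M = E \<longrightarrow> emeasure M E = 0 \<or> emeasure M (space M - E) = 0)"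

definition conservative_map :: "'a measure \<Rightarrow> ('a \<Rightarrow> 'a) \<Rightarrow> bool" where
  "conservative_map M F \<longleftrightarrow>
     (\<forall>W\<in>sets M. disjoint_family (\<lambda>n::nat. (F ^^ n) -` W \<inter> space M) \<longrightarrow> emeasure M W = 0)"

definition measure_preserving_map :: "'a measure \<Rightarrow> ('a \<Rightarrow> 'a) \<Rightarrow> bool" where
  "measure_preserving_map M F \<longleftrightarrow> F \<in> measurable M M \<and> distr M M F = M"

text \<open>The measure \<open>\<mu> \<circ> F\<close>, which counts images branch by branch.\<close>

definition measure_comp :: "'a measure \<Rightarrow> 'a set set \<Rightarrow> ('a \<Rightarrow> 'a) \<Rightarrow> 'a measure" where
  "measure_comp M \<alpha> F = measure_of (space M) (sets M)
     (\<lambda>B. \<integral>\<^sup>+ a. emeasure M (F ` (B \<inter> a)) \<partial>count_space \<alpha>)"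

text \<open>The function \<open>g\<close> is a version of \<open>log (d\<mu> / d(\<mu> \<circ> F))\<close>. Measurability of the images
  of measurable subsets of a branch is what makes \<open>\<mu> \<circ> F\<close> a measure.\<close>

definition full_branch_gibbs_markov ::
  "'a measure \<Rightarrow> 'a set set \<Rightarrow> ('a \<Rightarrow> 'a) \<Rightarrow> real \<Rightarrow> bool" where
  "full_branch_gibbs_markov M \<alpha> F \<theta> \<longleftrightarrow>
     countable \<alpha> \<and> \<alpha> \<subseteq> sets M \<and> \<Union>\<alpha> = space M \<and> disjoint \<alpha> \<and>
     measure_preserving_map M F \<and> ergodic_map M F \<and> conservative_map M F \<and>
     (\<forall>a\<in>\<alpha>. bij_betw F a (space M)) \<and>
     (\<forall>a\<in>\<alpha>. \<forall>B\<in>sets M. B \<subseteq> a \<longrightarrow> F ` B \<in> sets M) \<and>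
     (\<forall>y\<in>space M. \<forall>y'\<in>space M. y \<noteq> y' \<longrightarrow> sep_time \<alpha> F y y' \<noteq> \<infinity>) \<and>
     (\<exists>g\<in>borel_measurable M.
        M = density (measure_comp M \<alpha> F) (\<lambda>y. ennreal (exp (g y))) \<and>
        (\<exists>C. \<forall>a\<in>\<alpha>. \<forall>y\<in>a. \<forall>y'\<in>a. \<bar>g y - g y'\<bar> \<le> C * d_sep \<alpha> F \<theta> y y'))"


section \<open>Suspension semiflow\<close>

text \<open>The quotient by \<open>(y, \<phi> y) \<sim> (F y, 0)\<close> is represented by the points with
  \<open>0 \<le> u < \<phi> y\<close>, one in each equivalence class.\<close>

definition susp :: "'a measure \<Rightarrow> ('a \<Rightarrow> real) \<Rightarrow> ('a \<times> real) set" where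
  "susp M \<phi> = {(y, u). y \<in> space M \<and> 0 \<le> u \<and> u < \<phi> y}"

definition susp_measure :: "'a measure \<Rightarrow> ('a \<Rightarrow> real) \<Rightarrow> ('a \<times> real) measure" where
  "susp_measure M \<phi> =
     (let N = restrict_space (M \<Otimes>\<^sub>M lborel) (susp M \<phi>) in
      if integrable M \<phi> then scale_measure (ennreal (1 / (\<integral>y. \<phi> y \<partial>M))) N else N)"

definition birkhoff_sum :: "('a \<Rightarrow> 'a) \<Rightarrow> ('a \<Rightarrow> real) \<Rightarrow> nat \<Rightarrow> 'a \<Rightarrow> real" where
  "birkhoff_sum F \<phi> n y = (\<Sum>k<n. \<phi> ((F ^^ k) y))"

text \<open>For \<open>t \<ge> 0\<close>, the number of identifications to apply to \<open>(y, u + t)\<close> is the unique \<open>n\<close> with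
  \<open>\<phi>\<^sub>n y \<le> u + t < \<phi>\<^sub>n\<^sub>+\<^sub>1 y\<close>.\<close>

definition susp_flow ::
  "('a \<Rightarrow> 'a) \<Rightarrow> ('a \<Rightarrow> real) \<Rightarrow> real \<Rightarrow> 'a \<times> real \<Rightarrow> 'a \<times> real" where
  "susp_flow F \<phi> t = (\<lambda>(y, u).
     let n = (LEAST n. u + t < birkhoff_sum F \<phi> (Suc n) y)
     in ((F ^^ n) y, u + t - birkhoff_sum F \<phi> n y))"

definition Ytil :: "'a measure \<Rightarrow> ('a \<times> real) set" where
  "Ytil M = space M \<times> {0..1}"

definition mutil :: "'a measure \<Rightarrow> ('a \<times> real) measure" where
  "mutil M = M \<Otimes>\<^sub>M restrict_space lborel {0..1}"

definition Ftil :: "('a \<Rightarrow> 'a) \<Rightarrow> 'a \<times> real \<Rightarrow> 'a \<times> real" where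
  "Ftil F = (\<lambda>(y, u). (F y, u))"

definition phitil :: "('a \<Rightarrow> real) \<Rightarrow> 'a \<times> real \<Rightarrow> real" where
  "phitil \<phi> = (\<lambda>(y, u). \<phi> y)"


section \<open>Transfer operators and integrals of functions with values in \<open>L\<^sup>1\<close>\<close>

text \<open>Elements of \<open>L\<^sup>1\<close> are represented by integrable functions. Transfer operators and integrals
  are determined only almost everywhere and select a representative; since the defining
  properties depend only on the class of the argument, so does the result.\<close>

definition Linf :: "'b measure \<Rightarrow> ('b \<Rightarrow> complex) set" where
  "Linf M = {w \<in> borel_measurable M. \<exists>C. AE x in M. norm (w x) \<le> C}"

definition transfer_op ::
  "'b measure \<Rightarrow> ('b \<Rightarrow> 'b) \<Rightarrow> ('b \<Rightarrow> complex) \<Rightarrow> 'b \<Rightarrow> complex" where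
  "transfer_op M f v = (SOME h. integrable M h \<and>
     (\<forall>w\<in>Linf M. (\<integral>x. h x * w x \<partial>M) = (\<integral>x. v x * w (f x) \<partial>M)))"

text \<open>The Bochner integral over \<open>N\<close> of a function \<open>G\<close> with values in \<open>L\<^sup>1(M)\<close>: approximation by
  integrable simple functions, almost everywhere in the norm of \<open>L\<^sup>1(M)\<close> (strong measurability)
  and in the mean. The library's Bochner integral needs a type as codomain, which \<open>L\<^sup>1(M)\<close> is
  not.\<close>

definition L1_dist :: "'b measure \<Rightarrow> ('b \<Rightarrow> complex) \<Rightarrow> ('b \<Rightarrow> complex) \<Rightarrow> ennreal" where
  "L1_dist M f g = (\<integral>\<^sup>+ x. ennreal (norm (f x - g x)) \<partial>M)"

definition L1_simple :: "'t measure \<Rightarrow> 'b measure \<Rightarrow> ('t \<Rightarrow> 'b \<Rightarrow> complex) \<Rightarrow> bool" where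
  "L1_simple N M S \<longleftrightarrow> simple_function N S \<and> (\<forall>t\<in>space N. integrable M (S t)) \<and>
     emeasure N {t \<in> space N. S t \<noteq> (\<lambda>_. 0)} \<noteq> \<infinity>"

definition L1_simple_integral :: "'t measure \<Rightarrow> ('t \<Rightarrow> 'b \<Rightarrow> complex) \<Rightarrow> 'b \<Rightarrow> complex" where
  "L1_simple_integral N S x = (\<Sum>h\<in>S ` space N. measure N {t \<in> space N. S t = h} *\<^sub>R h x)"

definition has_L1_integral ::
  "'t measure \<Rightarrow> 'b measure \<Rightarrow> ('t \<Rightarrow> 'b \<Rightarrow> complex) \<Rightarrow> ('b \<Rightarrow> complex) \<Rightarrow> bool" where
  "has_L1_integral N M G I \<longleftrightarrow>
     (\<forall>t\<in>space N. integrable M (G t)) \<and> integrable M I \<and>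
     (\<exists>S. (\<forall>i::nat. L1_simple N M (S i)) \<and>
        (AE t in N. (\<lambda>i. L1_dist M (G t) (S i t)) \<longlonglongrightarrow> 0) \<and>
        (\<lambda>i. \<integral>\<^sup>+ t. L1_dist M (G t) (S i t) \<partial>N) \<longlonglongrightarrow> 0 \<and>
        (\<lambda>i. L1_dist M (L1_simple_integral N (S i)) I) \<longlonglongrightarrow> 0)"

definition L1_integral ::
  "'t measure \<Rightarrow> 'b measure \<Rightarrow> ('t \<Rightarrow> 'b \<Rightarrow> complex) \<Rightarrow> 'b \<Rightarrow> complex" where
  "L1_integral N M G = (SOME I. has_L1_integral N M G I)"


section \<open>The renewal operators\<close>

type_synonym 'a fn = "'a \<times> real \<Rightarrow> complex"

definition Lop :: "'a measure \<Rightarrow> ('a \<Rightarrow> 'a) \<Rightarrow> ('a \<Rightarrow> real) \<Rightarrow> real \<Rightarrow> 'a fn \<Rightarrow> 'a fn" where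
  "Lop M F \<phi> t = transfer_op (susp_measure M \<phi>) (susp_flow F \<phi> t)"

definition Rtil :: "'a measure \<Rightarrow> ('a \<Rightarrow> 'a) \<Rightarrow> 'a fn \<Rightarrow> 'a fn" where
  "Rtil M F = transfer_op (mutil M) (Ftil F)"

definition Top :: "'a measure \<Rightarrow> ('a \<Rightarrow> 'a) \<Rightarrow> ('a \<Rightarrow> real) \<Rightarrow> real \<Rightarrow> 'a fn \<Rightarrow> 'a fn" where
  "Top M F \<phi> t v =
     (\<lambda>p. indicator (Ytil M) p * Lop M F \<phi> t (\<lambda>q. indicator (Ytil M) q * v q) p)"

definition Uop :: "'a measure \<Rightarrow> ('a \<Rightarrow> 'a) \<Rightarrow> ('a \<Rightarrow> real) \<Rightarrow> real \<Rightarrow> 'a fn \<Rightarrow> 'a fn" where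
  "Uop M F \<phi> t v =
     (\<lambda>p. indicator (Ytil M) p *
       Lop M F \<phi> t (\<lambda>q. indicator {q \<in> Ytil M. phitil \<phi> q > t} q * v q) p)"

definition Rhat :: "'a measure \<Rightarrow> ('a \<Rightarrow> 'a) \<Rightarrow> ('a \<Rightarrow> real) \<Rightarrow> complex \<Rightarrow> 'a fn \<Rightarrow> 'a fn" where
  "Rhat M F \<phi> s v = Rtil M F (\<lambda>p. exp (- s * of_real (phitil \<phi> p)) * v p)"

definition That :: "'a measure \<Rightarrow> ('a \<Rightarrow> 'a) \<Rightarrow> ('a \<Rightarrow> real) \<Rightarrow> complex \<Rightarrow> 'a fn \<Rightarrow> 'a fn" where
  "That M F \<phi> s v = L1_integral (restrict_space lborel {0<..}) (mutil M)
     (\<lambda>t p. exp (- s * of_real t) * Top M F \<phi> t v p)"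

definition Uhat :: "'a measure \<Rightarrow> ('a \<Rightarrow> 'a) \<Rightarrow> ('a \<Rightarrow> real) \<Rightarrow> complex \<Rightarrow> 'a fn \<Rightarrow> 'a fn" where
  "Uhat M F \<phi> s v = L1_integral (restrict_space lborel {0<..}) (mutil M)
     (\<lambda>t p. exp (- s * of_real t) * Uop M F \<phi> t v p)"

end

theory Submission
  imports Defs "HOL-Probability.Sinc_Integral"
begin

text \<open>
  Every operator is tested against bounded functions \<open>w\<close>, extended by zero from \<open>Ytil\<close> to the
  suspension. Writing \<open>f t\<close> for the semiflow, the integral of \<open>Top t v \<cdot> w\<close> is that of
  \<open>v \<cdot> w \<circ> f t\<close>, so Fubini turns the integral of \<open>(That s v - Uhat s v) \<cdot> w\<close> into that of
  \<open>exp (- s t) v(p) w(f t p)\<close> over all \<open>(t, p)\<close> with \<open>t \<ge> \<phi>(p)\<close>. Since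
  \<open>f (t + \<phi> y) (y, u) = f t (F y, u)\<close>, the substitution \<open>t \<mapsto> t + \<phi>(p)\<close> followed by duality for
  \<open>Rtil\<close> gives the integral of \<open>That s (Rhat s v) \<cdot> w\<close>.

  As the operators are chosen by \<open>SOME\<close>, the transfer operators and the \<open>L\<^sup>1\<close>-valued integrals
  must be shown to exist. The former come from Radon--Nikodym. For the latter, \<open>t \<mapsto> Top t v\<close> is
  right continuous in \<open>L\<^sup>1\<close>, because \<open>f h\<close> translates \<open>Ytil\<close> for small \<open>h\<close> and translations are
  continuous in \<open>L\<^sup>1\<close>; sampling to the right of \<open>t\<close> then gives the approximating simple functions,
  and the value of the integral is again a Radon--Nikodym density.
\<close>


section \<open>Duality and transfer operators\<close>

text \<open>The obstacle behind the detour through duality: \<open>SOME\<close> selects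
  \<open>Top M F \<phi> t v\<close> separately for each \<open>t\<close>, so these functions come
  with no joint measurability in \<open>(t, p)\<close>, and Fubini cannot be applied to them. It is
  applied only after pairing with \<open>w\<close>, when the selected representative has given way
  to \<open>w\<close> along the flow, which is jointly measurable. The candidate for the integral
  over \<open>t\<close> is found on the product of times and points too, by pushing
  \<open>exp (- s t) v(p)\<close> forward along \<open>(t, p) \<mapsto> f t p\<close>. That
  identifies it weakly; the strong approximation demanded by \<open>has_L1_integral\<close> has to
  come from continuity in \<open>t\<close>.

  One-sided continuity is the natural form, because the cut-off \<open>t < \<phi>(p)\<close> in
  \<open>Uop\<close> is right continuous in \<open>t\<close> but jumps at \<open>\<phi>(p)\<close>.
  The number 2 is the height 1 of \<open>Ytil\<close> plus a time span 1 during which no point of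
  \<open>Ytil\<close> reaches the roof.\<close>

definition null_reflecting :: "'p measure \<Rightarrow> 'b measure \<Rightarrow> ('p \<Rightarrow> 'b) \<Rightarrow> bool" where
  "null_reflecting P M \<Phi> \<longleftrightarrow>
     \<Phi> \<in> measurable P M \<and> (\<forall>E\<in>null_sets M. \<Phi> -` E \<inter> space P \<in> null_sets P)"

lemma null_reflecting_AE:
  assumes "null_reflecting P M \<Phi>" "AE x in M. Q x"
  shows "AE x in P. Q (\<Phi> x)"
proof -
  obtain E where E: "E \<in> null_sets M" "{x \<in> space M. \<not> Q x} \<subseteq> E"
    using assms(2) by (auto simp: eventually_ae_filter)
  have "\<Phi> -` E \<inter> space P \<in> null_sets P" "\<Phi> \<in> measurable P M"
    using assms(1) E(1) by (auto simp: null_reflecting_def)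
  then show ?thesis
    by (intro AE_I'[of "\<Phi> -` E \<inter> space P"]) (use E(2) in \<open>auto dest: measurable_space\<close>)
qed

lemma Linf_bounded:
  assumes "w \<in> borel_measurable M" "\<And>x. x \<in> space M \<Longrightarrow> norm (w x) \<le> C"
  shows "w \<in> Linf M"
  using assms unfolding Linf_def by (auto intro!: exI[of _ C] AE_I2)

lemma Linf_compose:
  assumes "null_reflecting P M \<Phi>" "w \<in> Linf M"
  shows "(\<lambda>x. w (\<Phi> x)) \<in> Linf P"
proof -
  obtain C where "AE x in M. norm (w x) \<le> C" "w \<in> borel_measurable M"
    using assms(2) by (auto simp: Linf_def)
  then show ?thesis
    using null_reflecting_AE[OF assms(1), of "\<lambda>x. norm (w x) \<le> C"] assms(1)
      measurable_compose[of \<Phi> P M w borel]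
    unfolding Linf_def null_reflecting_def by blast
qed

lemma integrable_mult_Linf:
  fixes f :: "'b \<Rightarrow> complex"
  assumes "integrable M f" "w \<in> Linf M"
  shows "integrable M (\<lambda>x. f x * w x)"
proof -
  obtain C where C: "AE x in M. norm (w x) \<le> C" and w[measurable]: "w \<in> borel_measurable M"
    using assms(2) by (auto simp: Linf_def)
  have [measurable]: "f \<in> borel_measurable M" using assms(1) by auto
  have "integrable M (\<lambda>x. \<bar>C\<bar> * norm (f x))" using assms(1) by auto
  then show ?thesis
  proof (rule Bochner_Integration.integrable_bound)
    show "AE x in M. norm (f x * w x) \<le> norm (\<bar>C\<bar> * norm (f x))"
      using C by eventually_elim
        (auto simp: norm_mult abs_mult mult.commute[of "\<bar>C\<bar>"] intro!: mult_left_mono)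
  qed measurable
qed

text \<open>The density is the Radon-Nikodym derivative of the image under \<Phi> of the finite
  measure with density \<open>k\<close>. \<open>null_reflecting\<close> gives the absolute
  continuity that this requires, and for the flow it can be checked on countably many
  pieces.\<close>

lemma pushforward_density_nonneg:
  fixes k :: "'p \<Rightarrow> real" and M :: "'b measure"
  assumes M: "sigma_finite_measure M" and \<Phi>: "null_reflecting P M \<Phi>"
    and k: "integrable P k" and k0: "\<And>x. 0 \<le> k x"
  obtains h :: "'b \<Rightarrow> real" where "integrable M h"
    "\<And>w::'b \<Rightarrow> complex. w \<in> Linf M \<Longrightarrow>
      (\<integral>x. complex_of_real (h x) * w x \<partial>M) = (\<integral>x. complex_of_real (k x) * w (\<Phi> x) \<partial>P)"
proof -
  interpret sigma_finite_measure M by fact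
  have [measurable]: "\<Phi> \<in> measurable P M" "k \<in> borel_measurable P"
    using \<Phi> k by (auto simp: null_reflecting_def)
  define D where "D = density P (\<lambda>x. ennreal (k x))"
  define N where "N = distr D M \<Phi>"
  have [measurable_cong]: "sets D = sets P" by (simp add: D_def)
  have "emeasure D (space P) = (\<integral>\<^sup>+x. ennreal (k x) \<partial>P)"
    by (auto simp: D_def emeasure_density intro!: nn_integral_cong)
  also have "\<dots> < \<infinity>" using k k0 by (simp add: integrable_iff_bounded)
  finally have fD: "finite_measure D"
    by (intro finite_measureI) (auto simp: D_def)
  have fN: "finite_measure N"
    unfolding N_def by (rule finite_measure.finite_measure_distr[OF fD]) measurable
  have ac: "absolutely_continuous M N"
    unfolding absolutely_continuous_def
  proof
    fix E assume E: "E \<in> null_sets M"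
    then have "\<Phi> -` E \<inter> space P \<in> null_sets P" using \<Phi> by (auto simp: null_reflecting_def)
    then have "\<Phi> -` E \<inter> space P \<in> null_sets D"
      unfolding D_def by (rule absolutely_continuousI_density[unfolded absolutely_continuous_def, THEN subsetD, rotated]) simp
    with E show "E \<in> null_sets N"
      by (auto simp: N_def null_sets_def emeasure_distr D_def)
  qed
  obtain h where h[measurable]: "h \<in> borel_measurable M"
    and hN: "AE x in M. RN_deriv M N x = ennreal (h x)" and h0: "\<And>x. 0 \<le> h x"
    by (rule real_RN_deriv[OF fN ac]) (auto simp: N_def)
  have N: "N = density M (\<lambda>x. ennreal (h x))"
    using density_RN_deriv[OF ac] density_cong[OF _ _ hN] by (simp add: N_def)
  have "(\<integral>\<^sup>+x. ennreal (h x) \<partial>M) = emeasure N (space M)"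
    by (auto simp: N emeasure_density intro!: nn_integral_cong)
  also have "\<dots> < \<infinity>"
    using finite_measure.emeasure_finite[OF fN] by (simp add: top.not_eq_extremum)
  finally have hint: "integrable M h"
    using h0 by (simp add: integrable_iff_bounded)
  show ?thesis
  proof (rule that[OF hint])
    fix w :: "'b \<Rightarrow> complex" assume "w \<in> Linf M"
    then have [measurable]: "w \<in> borel_measurable M" by (simp add: Linf_def)
    have "(\<integral>x. complex_of_real (h x) * w x \<partial>M) = (\<integral>x. w x \<partial>N)"
      unfolding N by (subst integral_density) (auto simp: h0 scaleR_conv_of_real)
    also have "\<dots> = (\<integral>x. w (\<Phi> x) \<partial>D)"
      unfolding N_def by (rule integral_distr) measurable
    also have "\<dots> = (\<integral>x. complex_of_real (k x) * w (\<Phi> x) \<partial>P)"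
      unfolding D_def by (subst integral_density) (auto simp: k0 scaleR_conv_of_real)
    finally show "(\<integral>x. complex_of_real (h x) * w x \<partial>M) = (\<integral>x. complex_of_real (k x) * w (\<Phi> x) \<partial>P)" .
  qed
qed

text \<open>Positive and negative parts of \<open>Re k\<close> and \<open>Im k\<close> reduce this
  to nonnegative densities. With \<open>P = M\<close> it yields transfer operators; with
  \<open>P\<close> a product of times and points it yields the value of an integral over
  time.\<close>

lemma pushforward_density:
  fixes k :: "'p \<Rightarrow> complex" and M :: "'b measure"
  assumes M: "sigma_finite_measure M" and \<Phi>: "null_reflecting P M \<Phi>" and k: "integrable P k"
  shows "\<exists>h. integrable M h \<and>
    (\<forall>w\<in>Linf M. (\<integral>x. h x * w x \<partial>M) = (\<integral>x. k x * w (\<Phi> x) \<partial>P))"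
proof -
  define Q where "Q k \<longleftrightarrow> integrable P k \<and> (\<exists>h. integrable M h \<and>
    (\<forall>w\<in>Linf M. (\<integral>x. h x * w x \<partial>M) = (\<integral>x. k x * w (\<Phi> x) \<partial>P)))" for k :: "'p \<Rightarrow> complex"
  have nonneg: "Q (\<lambda>x. of_real (k x))" if k: "integrable P k" "\<And>x. 0 \<le> k x" for k
  proof -
    obtain h where "integrable M h"
      "\<And>w::'b \<Rightarrow> complex. w \<in> Linf M \<Longrightarrow>
        (\<integral>x. complex_of_real (h x) * w x \<partial>M) = (\<integral>x. complex_of_real (k x) * w (\<Phi> x) \<partial>P)"
      using pushforward_density_nonneg[OF M \<Phi> k] by blast
    then show ?thesis
      using k(1) by (auto simp: Q_def intro!: exI[of _ "\<lambda>x. of_real (h x)"])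
  qed
  have add: "Q (\<lambda>x. k x + c * l x)" if "Q k" "Q l" for k l and c :: complex
  proof -
    from that obtain hk hl where
      k: "integrable P k" "integrable M hk" "\<And>w. w \<in> Linf M \<Longrightarrow> (\<integral>x. hk x * w x \<partial>M) = (\<integral>x. k x * w (\<Phi> x) \<partial>P)" and
      l: "integrable P l" "integrable M hl" "\<And>w. w \<in> Linf M \<Longrightarrow> (\<integral>x. hl x * w x \<partial>M) = (\<integral>x. l x * w (\<Phi> x) \<partial>P)"
      unfolding Q_def by blast
    have "(\<integral>x. (hk x + c * hl x) * w x \<partial>M) = (\<integral>x. (k x + c * l x) * w (\<Phi> x) \<partial>P)" if w: "w \<in> Linf M" for w
      using integrable_mult_Linf[OF k(2) w] integrable_mult_Linf[OF l(2) w]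
        integrable_mult_Linf[OF k(1) Linf_compose[OF \<Phi> w]]
        integrable_mult_Linf[OF l(1) Linf_compose[OF \<Phi> w]] k(3)[OF w] l(3)[OF w]
      by (simp add: distrib_right mult.assoc)
    with k l show ?thesis
      by (auto simp: Q_def intro!: exI[of _ "\<lambda>x. hk x + c * hl x"])
  qed
  define r where "r x = max 0 (Re (k x))" for x
  define r' where "r' x = max 0 (- Re (k x))" for x
  define i where "i x = max 0 (Im (k x))" for x
  define i' where "i' x = max 0 (- Im (k x))" for x
  have "Q (\<lambda>x. of_real (r x))" "Q (\<lambda>x. of_real (r' x))" "Q (\<lambda>x. of_real (i x))" "Q (\<lambda>x. of_real (i' x))"
    using k by (auto intro!: nonneg integrable_max simp: r_def r'_def i_def i'_def)
  then have "Q (\<lambda>x. ((of_real (r x) + (-1) * of_real (r' x)) + \<i> * of_real (i x)) + (-\<i>) * of_real (i' x))"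
    by (intro add)
  also have "(\<lambda>x. ((of_real (r x) + (-1) * of_real (r' x)) + \<i> * of_real (i x)) + (-\<i>) * of_real (i' x)) = k"
    by (auto simp: fun_eq_iff complex_eq_iff r_def r'_def i_def i'_def)
  finally show ?thesis by (simp add: Q_def)
qed

lemma transfer_op_spec:
  assumes "sigma_finite_measure M" "null_reflecting M M f" "integrable M v"
  shows "integrable M (transfer_op M f v)"
    and "w \<in> Linf M \<Longrightarrow> (\<integral>x. transfer_op M f v x * w x \<partial>M) = (\<integral>x. v x * w (f x) \<partial>M)"
  using someI_ex[OF pushforward_density[OF assms]] by (auto simp: transfer_op_def)

text \<open>The bound holds at every point, not just almost everywhere, so it survives extension by
  zero and composition with the flow without any argument about null sets.\<close>

definition unit_test :: "'b measure \<Rightarrow> ('b \<Rightarrow> complex) \<Rightarrow> bool" where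
  "unit_test M w \<longleftrightarrow> w \<in> borel_measurable M \<and> (\<forall>x. norm (w x) \<le> 1)"

lemma unit_test_Linf: "unit_test M w \<Longrightarrow> w \<in> Linf M"
  using Linf_bounded[of w M 1] by (simp add: unit_test_def)

lemma norm_integral_unit_test_le:
  assumes "integrable M f" "unit_test M w"
  shows "norm (\<integral>x. f x * w x \<partial>M) \<le> (\<integral>x. norm (f x) \<partial>M)"
proof -
  have "norm (\<integral>x. f x * w x \<partial>M) \<le> (\<integral>x. norm (f x * w x) \<partial>M)" by (rule integral_norm_bound)
  also have "\<dots> \<le> (\<integral>x. norm (f x) \<partial>M)"
    using integrable_mult_Linf[OF assms(1) unit_test_Linf[OF assms(2)]] assms
    by (intro integral_mono integrable_norm) (auto simp: unit_test_def norm_mult intro!: mult_left_le)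
  finally show ?thesis .
qed

lemma unit_test_attains_norm:
  assumes "integrable M f"
  obtains w where "unit_test M w" "(\<integral>x. f x * w x \<partial>M) = complex_of_real (\<integral>x. norm (f x) \<partial>M)"
proof -
  \<comment> \<open>The conjugate phase of \<open>f\<close>. Where \<open>f\<close> vanishes,
    division by zero gives \<open>w x = 0\<close>, so the bound 1 holds there as well.\<close>
  define w where "w x = cnj (f x) / complex_of_real (norm (f x))" for x
  have [measurable]: "f \<in> borel_measurable M" using assms by auto
  have "(\<lambda>x. cnj (f x)) \<in> borel_measurable M"
    by (rule measurable_compose[OF _ borel_measurable_continuous_onI]) (auto intro: continuous_intros)
  then have "unit_test M w"
    by (auto simp: unit_test_def w_def[abs_def] norm_divide divide_le_eq_1)
  moreover have "f x * w x = complex_of_real (norm (f x))" for x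
  proof (cases "f x = 0")
    case False
    have "f x * w x = (f x * cnj (f x)) / complex_of_real (norm (f x))"
      by (simp add: w_def)
    also have "\<dots> = complex_of_real (norm (f x))"
      using False by (simp add: complex_norm_square[symmetric] power2_eq_square)
    finally show ?thesis .
  qed (simp add: w_def)
  then have "(\<integral>x. f x * w x \<partial>M) = complex_of_real (\<integral>x. norm (f x) \<partial>M)"
    by simp
  ultimately show ?thesis using that by blast
qed

text \<open>Operators selected by \<open>SOME\<close> are known only through their pairings; this
  turns bounds on pairings into L1 bounds.\<close>

lemma norm_integral_le_by_duality:
  assumes "integrable M f" "\<And>w. unit_test M w \<Longrightarrow> norm (\<integral>x. f x * w x \<partial>M) \<le> B"
  shows "(\<integral>x. norm (f x) \<partial>M) \<le> B"
proof -
  obtain w where "unit_test M w" "(\<integral>x. f x * w x \<partial>M) = complex_of_real (\<integral>x. norm (f x) \<partial>M)"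
    using unit_test_attains_norm[OF assms(1)] .
  with assms(2)[of w] show ?thesis by (metis norm_of_real abs_le_D1)
qed

lemma AE_eq_by_duality:
  assumes "integrable M f" "integrable M g"
    "\<And>w. unit_test M w \<Longrightarrow> (\<integral>x. f x * w x \<partial>M) = (\<integral>x. g x * w x \<partial>M)"
  shows "AE x in M. f x = g x"
proof -
  have "(\<integral>x. norm (f x - g x) \<partial>M) \<le> 0"
  proof (rule norm_integral_le_by_duality)
    fix w assume w: "unit_test M w"
    show "norm (\<integral>x. (f x - g x) * w x \<partial>M) \<le> 0"
      using assms(3)[OF w] integrable_mult_Linf[OF assms(1) unit_test_Linf[OF w]]
        integrable_mult_Linf[OF assms(2) unit_test_Linf[OF w]]
      by (simp add: left_diff_distrib)
  qed (use assms in auto)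
  then have "(\<integral>x. norm (f x - g x) \<partial>M) = 0"
    by (simp add: antisym)
  then have "AE x in M. norm (f x - g x) = 0"
    using assms by (subst (asm) integral_nonneg_eq_0_iff_AE) auto
  then show ?thesis by simp
qed

lemma L1_dist_eq_integral:
  assumes "integrable M f" "integrable M g"
  shows "L1_dist M f g = ennreal (\<integral>x. norm (f x - g x) \<partial>M)"
  unfolding L1_dist_def using assms by (intro nn_integral_eq_integral) auto


section \<open>Continuity of translations\<close>

lemma lborel_integral_translate:
  fixes f :: "real \<Rightarrow> 'c::{banach, second_countable_topology}"
  shows "(\<integral>x. f (x + c) \<partial>lborel) = (\<integral>x. f x \<partial>lborel)"
  using lborel_integral_real_affine[of 1 f c] by (simp add: add.commute)

lemma integrable_lborel_translate:
  fixes f :: "real \<Rightarrow> 'c::{banach, second_countable_topology}"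
  shows "integrable lborel (\<lambda>x. f (x + c)) \<longleftrightarrow> integrable lborel f"
  using lborel_integrable_real_affine_iff[of 1 f c] by (simp add: add.commute)

lemma L1_translation_approx:
  fixes f :: "real \<Rightarrow> 'c::{banach, second_countable_topology}"
  assumes f: "integrable lborel f"
    and approx: "\<And>e. e > 0 \<Longrightarrow> \<exists>g. integrable lborel g \<and>
      (\<lambda>i. \<integral>x. norm (g (x + h i) - g x) \<partial>lborel) \<longlonglongrightarrow> 0 \<and> (\<integral>x. norm (f x - g x) \<partial>lborel) \<le> e"
  shows "(\<lambda>i. \<integral>x. norm (f (x + h i) - f x) \<partial>lborel) \<longlonglongrightarrow> 0"
proof (rule LIMSEQ_I)
  fix r :: real assume r: "0 < r"
  \<comment> \<open>Translations preserve the L1 norm, so replacing \<open>f\<close> by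
    \<open>g\<close> is paid for twice, once for each of the two terms. This uses up half of
    \<open>r\<close> and leaves the other half for \<open>g\<close>.\<close>
  obtain g where g: "integrable lborel g" "(\<lambda>i. \<integral>x. norm (g (x + h i) - g x) \<partial>lborel) \<longlonglongrightarrow> 0"
    "(\<integral>x. norm (f x - g x) \<partial>lborel) \<le> r / 4"
    using approx[of "r / 4"] r by auto
  obtain n where n: "\<And>i. i \<ge> n \<Longrightarrow> norm ((\<integral>x. norm (g (x + h i) - g x) \<partial>lborel) - 0) < r / 2"
    using LIMSEQ_D[OF g(2), of "r / 2"] r by auto
  have "(\<integral>x. norm (f (x + h i) - f x) \<partial>lborel)
      \<le> (\<integral>x. norm (g (x + h i) - g x) \<partial>lborel) + 2 * (\<integral>x. norm (f x - g x) \<partial>lborel)" for i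
  proof -
    have int: "integrable lborel (\<lambda>x. f (x + h i))" "integrable lborel (\<lambda>x. g (x + h i))"
      using f g(1) by (auto simp: integrable_lborel_translate)
    have "(\<integral>x. norm (f (x + h i) - f x) \<partial>lborel)
      \<le> (\<integral>x. norm (f (x + h i) - g (x + h i)) + norm (g (x + h i) - g x) + norm (f x - g x) \<partial>lborel)"
    proof (rule integral_mono)
      show "norm (f (x + h i) - f x)
        \<le> norm (f (x + h i) - g (x + h i)) + norm (g (x + h i) - g x) + norm (f x - g x)" for x
        using norm_triangle_ineq[of "f (x + h i) - g (x + h i)" "g (x + h i) - g x"]
          norm_triangle_ineq4[of "f (x + h i) - g x" "f x - g x"] by simp
    qed (use int f g(1) in auto)
    also have "\<dots> = (\<integral>x. norm (f (x + h i) - g (x + h i)) \<partial>lborel)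
        + (\<integral>x. norm (g (x + h i) - g x) \<partial>lborel) + (\<integral>x. norm (f x - g x) \<partial>lborel)"
      using int f g(1) by simp
    also have "(\<integral>x. norm (f (x + h i) - g (x + h i)) \<partial>lborel) = (\<integral>x. norm (f x - g x) \<partial>lborel)"
      by (rule lborel_integral_translate[of "\<lambda>x. norm (f x - g x)"])
    finally show ?thesis by simp
  qed
  note le = this
  have "norm ((\<integral>x. norm (f (x + h i) - f x) \<partial>lborel) - 0) < r" if "i \<ge> n" for i
    using n[OF that] g(3) r le[of i] by (simp add: abs_of_nonneg)
  then show "\<exists>n. \<forall>i\<ge>n. norm ((\<integral>x. norm (f (x + h i) - f x) \<partial>lborel) - 0) < r" by blast
qed

text \<open>A point of an open set stays in it under small translations, so the positive part of
  \<open>indicator U x - indicator U (x + h i)\<close> tends to 0 pointwise and is dominated by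
  \<open>indicator U\<close>. The negative part needs no limit of its own: both indicators have the
  same integral, so the two parts do too.\<close>

lemma L1_translation_open:
  fixes U :: "real set" and c :: "'c::{banach, second_countable_topology}"
  assumes U: "open U" "emeasure lborel U < \<infinity>" and h: "h \<longlonglongrightarrow> 0"
  shows "(\<lambda>i. \<integral>x. norm (indicator U (x + h i) *\<^sub>R c - indicator U x *\<^sub>R c) \<partial>lborel) \<longlonglongrightarrow> 0"
proof -
  define b where "b i x = (indicator U x - indicator U (x + h i) :: real)" for i x
  have [measurable]: "U \<in> sets borel" using U by auto
  have intU: "integrable lborel (indicator U :: real \<Rightarrow> real)"
    using U by auto
  then have intU': "integrable lborel (\<lambda>x. indicator U (x + h i) :: real)" for i
    by (simp add: integrable_lborel_translate)
  have intb: "integrable lborel (b i)" for i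
    unfolding b_def using intU intU' by auto
  have b0: "(\<integral>x. b i x \<partial>lborel) = 0" for i
    using intU intU'[of i] lborel_integral_translate[of "indicator U :: real \<Rightarrow> real" "h i"]
    by (simp add: b_def)
  have "(\<lambda>i. \<integral>x. max 0 (b i x) \<partial>lborel) \<longlonglongrightarrow> integral\<^sup>L lborel (\<lambda>_::real. 0)"
  proof (rule integral_dominated_convergence[where w = "indicator U :: real \<Rightarrow> real"])
    show "AE x in lborel. (\<lambda>i. max 0 (b i x)) \<longlonglongrightarrow> 0"
    proof (rule AE_I2, rule tendsto_eventually)
      fix x
      have "(\<lambda>i. x + h i) \<longlonglongrightarrow> x" using tendsto_add[OF tendsto_const h, of x] by simp
      then have "\<forall>\<^sub>F i in sequentially. x \<in> U \<longrightarrow> x + h i \<in> U"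
        using topological_tendstoD[OF _ U(1)] by (cases "x \<in> U") auto
      then show "\<forall>\<^sub>F i in sequentially. max 0 (b i x) = 0"
        by eventually_elim (auto simp: b_def indicator_def)
    qed
  qed (use intU in \<open>auto simp: b_def indicator_def\<close>)
  \<comment> \<open>Here \<open>\<bar>b\<bar> = 2 * max 0 b - b\<close>, and \<open>b\<close>
    integrates to 0.\<close>
  moreover have "norm (indicator U (x + h i) *\<^sub>R c - indicator U x *\<^sub>R c) = (2 * max 0 (b i x) - b i x) * norm c" for i x
    by (auto simp: b_def indicator_def)
  then have "(\<integral>x. norm (indicator U (x + h i) *\<^sub>R c - indicator U x *\<^sub>R c) \<partial>lborel)
      = (2 * (\<integral>x. max 0 (b i x) \<partial>lborel)) * norm c" for i
    using intb[of i] b0[of i] by (simp add: integrable_max)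
  ultimately show ?thesis by (auto intro!: tendsto_eq_intros)
qed

text \<open>Outer regularity passes from Borel sets of finite measure to open sets; the remaining
  cases of the induction for integrable functions are the triangle inequality and approximation by a
  dominated sequence.\<close>

lemma L1_translation_continuous:
  fixes f :: "real \<Rightarrow> 'c::{banach, second_countable_topology}"
  assumes "integrable lborel f" and h: "h \<longlonglongrightarrow> 0"
  shows "(\<lambda>i. \<integral>x. norm (f (x + h i) - f x) \<partial>lborel) \<longlonglongrightarrow> 0"
  using assms(1)
proof induction
  case (base A c)
  have [measurable]: "A \<in> sets borel" using base by simp
  have intA: "integrable lborel (\<lambda>x. indicator A x *\<^sub>R c)" using base by auto
  show ?case
  proof (rule L1_translation_approx[OF intA])
    fix e :: real assume e: "e > 0"
    \<comment> \<open>The summand 1 keeps the denominator positive when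
      \<open>c = 0\<close>.\<close>
    define d where "d = e / (norm c + 1)"
    have d: "d > 0" using e by (auto simp: d_def add_nonneg_pos)
    obtain U where U: "open U" "A \<subseteq> U" "emeasure lborel (U - A) < d"
      using outer_regular_lborel[OF _ d] by (metis \<open>A \<in> sets borel\<close>)
    have [measurable]: "U \<in> sets borel" using U by auto
    have fin: "emeasure lborel (U - A) < \<infinity>" using U(3) by (auto intro: order.strict_trans)
    have "emeasure lborel U = emeasure lborel A + emeasure lborel (U - A)"
      using U(2) by (subst plus_emeasure) (auto intro: arg_cong[where f="emeasure lborel"])
    then have finU: "emeasure lborel U < \<infinity>" using base fin by simp
    have "(\<integral>x. norm (indicator A x *\<^sub>R c - indicator U x *\<^sub>R c) \<partial>lborel) = (\<integral>x. indicator (U - A) x * norm c \<partial>lborel)"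
      using U(2) by (intro Bochner_Integration.integral_cong) (auto simp: indicator_def)
    also have "\<dots> = measure lborel (U - A) * norm c"
      using fin by simp
    also have "\<dots> \<le> d * norm c"
      using U(3) d by (intro mult_right_mono) (auto simp: measure_def intro!: enn2real_leI)
    also have "\<dots> \<le> e"
      using e by (simp add: d_def divide_le_eq add_nonneg_pos)
    finally show "\<exists>g. integrable lborel g \<and> (\<lambda>i. \<integral>x. norm (g (x + h i) - g x) \<partial>lborel) \<longlonglongrightarrow> 0 \<and>
        (\<integral>x. norm (indicator A x *\<^sub>R c - g x) \<partial>lborel) \<le> e"
      using L1_translation_open[OF U(1) finU h, of c] finU
      by (intro exI[of _ "\<lambda>x. indicator U x *\<^sub>R c"]) auto
  qed
next
  case (add f g)
  have int: "integrable lborel (\<lambda>x. f (x + h i))" "integrable lborel (\<lambda>x. g (x + h i))" for i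
    using add by (auto simp: integrable_lborel_translate)
  have "(\<integral>x. norm (f (x + h i) + g (x + h i) - (f x + g x)) \<partial>lborel)
      \<le> (\<integral>x. norm (f (x + h i) - f x) + norm (g (x + h i) - g x) \<partial>lborel)" for i
    using add int[of i] by (intro integral_mono) (auto intro: norm_diff_triangle_ineq)
  also have "(\<integral>x. norm (f (x + h i) - f x) + norm (g (x + h i) - g x) \<partial>lborel)
      = (\<integral>x. norm (f (x + h i) - f x) \<partial>lborel) + (\<integral>x. norm (g (x + h i) - g x) \<partial>lborel)" for i
    using add int[of i] by simp
  finally have le: "(\<integral>x. norm (f (x + h i) + g (x + h i) - (f x + g x)) \<partial>lborel)
      \<le> (\<integral>x. norm (f (x + h i) - f x) \<partial>lborel) + (\<integral>x. norm (g (x + h i) - g x) \<partial>lborel)" for i .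
  show ?case
    by (rule tendsto_sandwich[OF _ _ tendsto_const tendsto_add_zero[OF add.IH]]) (simp_all add: le)
next
  case (lim f s)
  show ?case
  proof (rule L1_translation_approx[OF lim.hyps(4)])
    fix e :: real assume e: "e > 0"
    \<comment> \<open>The induction rule bounds \<open>s i\<close> by twice the norm of
      \<open>f\<close>; one more copy for \<open>f\<close> itself gives the factor 3.\<close>
    have "(\<lambda>i. \<integral>x. norm (f x - s i x) \<partial>lborel) \<longlonglongrightarrow> integral\<^sup>L lborel (\<lambda>_::real. 0)"
    proof (rule integral_dominated_convergence[where w = "\<lambda>x. 3 * norm (f x)"])
      show "AE x in lborel. (\<lambda>i. norm (f x - s i x)) \<longlonglongrightarrow> 0"
        using lim.hyps(2) by (auto intro!: AE_I2 tendsto_eq_intros)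
      show "AE x in lborel. norm (norm (f x - s i x)) \<le> 3 * norm (f x)" for i
        using lim.hyps(3)[of _ i] by (auto intro!: AE_I2 order_trans[OF norm_triangle_ineq4])
    qed (use lim in auto)
    then have "(\<lambda>i. \<integral>x. norm (f x - s i x) \<partial>lborel) \<longlonglongrightarrow> 0" by simp
    from order_tendstoD(2)[OF this e] obtain i where "(\<integral>x. norm (f x - s i x) \<partial>lborel) < e"
      unfolding eventually_sequentially by blast
    then show "\<exists>g. integrable lborel g \<and> (\<lambda>i. \<integral>x. norm (g (x + h i) - g x) \<partial>lborel) \<longlonglongrightarrow> 0 \<and>
        (\<integral>x. norm (f x - g x) \<partial>lborel) \<le> e"
      using lim.hyps(1) lim.IH by (intro exI[of _ "s i"]) auto
  qed
qed

section \<open>Integrals with values in \<open>L\<^sup>1\<close>\<close>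

lemma integrable_L1_simple_integral:
  assumes "L1_simple N M S"
  shows "integrable M (L1_simple_integral N S)"
  using assms unfolding L1_simple_integral_def[abs_def] L1_simple_def
  by (intro Bochner_Integration.integrable_sum integrable_scaleR_right) auto

text \<open>Pairing with \<open>w\<close> is linear on L1 and \<open>S\<close> takes finitely many
  values, so the pairing goes through the defining sum term by term.\<close>

lemma L1_simple_integral_unit_test:
  assumes S: "L1_simple N M S" and w: "unit_test M w"
  shows "integrable N (\<lambda>t. \<integral>x. S t x * w x \<partial>M)"
    and "(\<integral>x. L1_simple_integral N S x * w x \<partial>M) = (\<integral>t. (\<integral>x. S t x * w x \<partial>M) \<partial>N)"
proof -
  define \<Psi> where "\<Psi> h = (\<integral>x. h x * w x \<partial>M)" for h
  define A where "A h = {t \<in> space N. S t = h}" for h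
  have sf: "simple_function N S" and int: "\<And>t. t \<in> space N \<Longrightarrow> integrable M (S t)"
    and fin: "emeasure N {t \<in> space N. S t \<noteq> (\<lambda>_. 0)} \<noteq> \<infinity>"
    using S by (auto simp: L1_simple_def)
  have finite: "finite (S ` space N)" using sf by (rule simple_functionD)
  have A: "A h \<in> sets N" for h
  proof -
    have "A h = S -` {h} \<inter> space N" by (auto simp: A_def)
    then show ?thesis using simple_functionD(2)[OF sf, of "{h}"] by simp
  qed
  have A_fin: "emeasure N (A h) < \<infinity>" if "h \<noteq> (\<lambda>_. 0)" for h
  proof -
    have "{t \<in> space N. S t \<noteq> (\<lambda>_. 0)} = space N - A (\<lambda>_. 0)" by (auto simp: A_def)
    then have "{t \<in> space N. S t \<noteq> (\<lambda>_. 0)} \<in> sets N" using A by auto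
    then have "emeasure N (A h) \<le> emeasure N {t \<in> space N. S t \<noteq> (\<lambda>_. 0)}"
      using that by (intro emeasure_mono) (auto simp: A_def)
    with fin show ?thesis by (simp add: top.not_eq_extremum order.strict_trans1)
  qed
  \<comment> \<open>The value 0 may be attained on a set of infinite measure, but its pairing is 0;
    all other values are attained on sets of finite measure.\<close>
  have term_int: "integrable N (\<lambda>t. indicator (A h) t *\<^sub>R \<Psi> h)" for h
    using A[of h] A_fin[of h] by (cases "h = (\<lambda>_. 0)") (auto simp: \<Psi>_def)
  have decomp: "\<Psi> (S t) = (\<Sum>h\<in>S ` space N. indicator (A h) t *\<^sub>R \<Psi> h)" if "t \<in> space N" for t
  proof -
    have "(\<Sum>h\<in>S ` space N. indicator (A h) t *\<^sub>R \<Psi> h) = (\<Sum>h\<in>S ` space N. if h = S t then \<Psi> h else 0)"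
      using that by (intro sum.cong) (auto simp: A_def)
    also have "\<dots> = \<Psi> (S t)" using that finite by simp
    finally show ?thesis by simp
  qed
  show int\<Psi>: "integrable N (\<lambda>t. \<integral>x. S t x * w x \<partial>M)"
    using term_int by (subst Bochner_Integration.integrable_cong[OF refl decomp[unfolded \<Psi>_def]])
      (auto simp: \<Psi>_def)
  have "(\<integral>t. \<Psi> (S t) \<partial>N) = (\<integral>t. (\<Sum>h\<in>S ` space N. indicator (A h) t *\<^sub>R \<Psi> h) \<partial>N)"
    by (intro Bochner_Integration.integral_cong refl decomp)
  also have "\<dots> = (\<Sum>h\<in>S ` space N. (\<integral>t. indicator (A h) t *\<^sub>R \<Psi> h \<partial>N))"
    using term_int by (intro Bochner_Integration.integral_sum) auto
  also have "\<dots> = (\<Sum>h\<in>S ` space N. measure N (A h) *\<^sub>R \<Psi> h)"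
  proof (intro sum.cong refl)
    fix h
    show "(\<integral>t. indicator (A h) t *\<^sub>R \<Psi> h \<partial>N) = measure N (A h) *\<^sub>R \<Psi> h"
      using A[of h] A_fin[of h] by (cases "h = (\<lambda>_. 0)") (auto simp: \<Psi>_def)
  qed
  also have "\<dots> = (\<Sum>h\<in>S ` space N. (\<integral>x. measure N (A h) *\<^sub>R (h x * w x) \<partial>M))"
    by (simp add: \<Psi>_def)
  also have "\<dots> = (\<integral>x. (\<Sum>h\<in>S ` space N. measure N (A h) *\<^sub>R (h x * w x)) \<partial>M)"
    using int integrable_mult_Linf[OF _ unit_test_Linf[OF w]]
    by (intro Bochner_Integration.integral_sum[symmetric]) auto
  also have "\<dots> = (\<integral>x. L1_simple_integral N S x * w x \<partial>M)"
    by (simp add: L1_simple_integral_def A_def sum_distrib_right)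
  finally show "(\<integral>x. L1_simple_integral N S x * w x \<partial>M) = (\<integral>t. (\<integral>x. S t x * w x \<partial>M) \<partial>N)"
    by (simp add: \<Psi>_def)
qed

text \<open>Pairing with a function bounded by 1 is 1-Lipschitz in L1. The bound is the same for all
  \<open>w\<close>, which later permits a test function that varies with the approximant.\<close>

lemma L1_simple_integral_dual_error:
  assumes S: "L1_simple N M S" and w: "unit_test M w"
    and G: "\<And>t. t \<in> space N \<Longrightarrow> integrable M (G t)"
    and Gw: "integrable N (\<lambda>t. \<integral>x. G t x * w x \<partial>M)"
  shows "ennreal (norm ((\<integral>x. L1_simple_integral N S x * w x \<partial>M) - (\<integral>t. (\<integral>x. G t x * w x \<partial>M) \<partial>N)))
    \<le> (\<integral>\<^sup>+ t. L1_dist M (G t) (S t) \<partial>N)"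
proof -
  have "(\<integral>x. L1_simple_integral N S x * w x \<partial>M) - (\<integral>t. (\<integral>x. G t x * w x \<partial>M) \<partial>N)
      = (\<integral>t. (\<integral>x. S t x * w x \<partial>M) - (\<integral>x. G t x * w x \<partial>M) \<partial>N)"
    using L1_simple_integral_unit_test[OF S w] Gw by simp
  then have "ennreal (norm ((\<integral>x. L1_simple_integral N S x * w x \<partial>M) - (\<integral>t. (\<integral>x. G t x * w x \<partial>M) \<partial>N)))
      \<le> (\<integral>\<^sup>+ t. ennreal (norm ((\<integral>x. S t x * w x \<partial>M) - (\<integral>x. G t x * w x \<partial>M))) \<partial>N)"
    using integral_norm_bound_ennreal[OF
        Bochner_Integration.integrable_diff[OF L1_simple_integral_unit_test(1)[OF S w] Gw]]
    by simp
  also have "\<dots> \<le> (\<integral>\<^sup>+ t. L1_dist M (G t) (S t) \<partial>N)"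
  proof (rule nn_integral_mono)
    fix t assume t: "t \<in> space N"
    then have int: "integrable M (S t)" "integrable M (G t)"
      using S G by (auto simp: L1_simple_def)
    then have "(\<integral>x. S t x * w x \<partial>M) - (\<integral>x. G t x * w x \<partial>M) = (\<integral>x. (S t x - G t x) * w x \<partial>M)"
      using integrable_mult_Linf[OF _ unit_test_Linf[OF w]] by (simp add: left_diff_distrib)
    then have "norm ((\<integral>x. S t x * w x \<partial>M) - (\<integral>x. G t x * w x \<partial>M)) \<le> (\<integral>x. norm (G t x - S t x) \<partial>M)"
      using norm_integral_unit_test_le[of M "\<lambda>x. S t x - G t x" w] int w by (simp add: norm_minus_commute)
    then show "ennreal (norm ((\<integral>x. S t x * w x \<partial>M) - (\<integral>x. G t x * w x \<partial>M))) \<le> L1_dist M (G t) (S t)"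
      using int by (simp add: L1_dist_eq_integral ennreal_leI)
  qed
  finally show ?thesis .
qed

text \<open>This determines the pairings of whichever value \<open>SOME\<close> selects: the
  approximants already satisfy the formula up to their mean error, and both errors tend to
  0.\<close>

lemma has_L1_integral_unit_test:
  assumes I: "has_L1_integral N M G I" and w: "unit_test M w"
    and Gw: "integrable N (\<lambda>t. \<integral>x. G t x * w x \<partial>M)"
  shows "(\<integral>x. I x * w x \<partial>M) = (\<integral>t. (\<integral>x. G t x * w x \<partial>M) \<partial>N)"
proof -
  obtain S where S: "\<And>i::nat. L1_simple N M (S i)"
    and lim: "(\<lambda>i. \<integral>\<^sup>+ t. L1_dist M (G t) (S i t) \<partial>N) \<longlonglongrightarrow> 0"
      "(\<lambda>i. L1_dist M (L1_simple_integral N (S i)) I) \<longlonglongrightarrow> 0"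
    and G: "\<And>t. t \<in> space N \<Longrightarrow> integrable M (G t)" and intI: "integrable M I"
    using I by (auto simp: has_L1_integral_def)
  let ?J = "\<lambda>i. L1_simple_integral N (S i)"
  let ?X = "\<integral>t. (\<integral>x. G t x * w x \<partial>M) \<partial>N"
  have bound: "ennreal (norm ((\<integral>x. I x * w x \<partial>M) - ?X))
      \<le> L1_dist M (?J i) I + (\<integral>\<^sup>+ t. L1_dist M (G t) (S i t) \<partial>N)" for i
  proof -
    have J: "integrable M (?J i)" by (rule integrable_L1_simple_integral[OF S])
    have "(\<integral>x. ?J i x * w x \<partial>M) - (\<integral>x. I x * w x \<partial>M) = (\<integral>x. (?J i x - I x) * w x \<partial>M)"
      using integrable_mult_Linf[OF J unit_test_Linf[OF w]] integrable_mult_Linf[OF intI unit_test_Linf[OF w]]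
      by (simp add: left_diff_distrib)
    then have 1: "ennreal (norm ((\<integral>x. ?J i x * w x \<partial>M) - (\<integral>x. I x * w x \<partial>M))) \<le> L1_dist M (?J i) I"
      using norm_integral_unit_test_le[of M "\<lambda>x. ?J i x - I x" w] J intI w
      by (simp add: L1_dist_eq_integral ennreal_leI)
    have "ennreal (norm ((\<integral>x. I x * w x \<partial>M) - ?X))
        \<le> ennreal (norm ((\<integral>x. ?J i x * w x \<partial>M) - (\<integral>x. I x * w x \<partial>M)) + norm ((\<integral>x. ?J i x * w x \<partial>M) - ?X))"
      using norm_triangle_ineq4[of "(\<integral>x. ?J i x * w x \<partial>M) - ?X"
          "(\<integral>x. ?J i x * w x \<partial>M) - (\<integral>x. I x * w x \<partial>M)"]
      by (intro ennreal_leI) (simp add: add.commute)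
    also have "\<dots> \<le> L1_dist M (?J i) I + (\<integral>\<^sup>+ t. L1_dist M (G t) (S i t) \<partial>N)"
      using 1 L1_simple_integral_dual_error[OF S w G Gw, of i] by (simp add: ennreal_plus add_mono)
    finally show ?thesis .
  qed
  have "(\<lambda>i. L1_dist M (?J i) I + (\<integral>\<^sup>+ t. L1_dist M (G t) (S i t) \<partial>N)) \<longlonglongrightarrow> 0 + 0"
    by (intro tendsto_add lim)
  then have "ennreal (norm ((\<integral>x. I x * w x \<partial>M) - ?X)) \<le> 0"
    using bound by (intro LIMSEQ_le_const[where X = "\<lambda>i. L1_dist M (?J i) I + (\<integral>\<^sup>+ t. L1_dist M (G t) (S i t) \<partial>N)"]) auto
  then show ?thesis by (simp add: ennreal_eq_0_iff)
qed

section \<open>Laplace integrals by sampling to the right\<close>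

lemma norm_exp_mult_of_real: "norm (exp (- s * complex_of_real t)) = exp (- Re s * t)"
  by simp

text \<open>The first point of the grid of mesh \<open>1 / (i + 1)\<close> that lies strictly to the
  right of \<open>t\<close>. Floor plus one, instead of the ceiling, keeps the inequality strict at
  grid points as well.\<close>

definition sample_time :: "nat \<Rightarrow> real \<Rightarrow> real" where
  "sample_time i t = of_int (\<lfloor>real (Suc i) * t\<rfloor> + 1) / real (Suc i)"

lemma sample_time_gt: "t < sample_time i t"
proof -
  have "real (Suc i) * t < of_int (\<lfloor>real (Suc i) * t\<rfloor> + 1)" by linarith
  then show ?thesis unfolding sample_time_def by (simp add: less_divide_eq mult.commute del: of_nat_Suc)
qed

lemma sample_time_le: "sample_time i t \<le> t + inverse (real (Suc i))"
proof -
  have "of_int (\<lfloor>real (Suc i) * t\<rfloor> + 1) \<le> real (Suc i) * t + 1" by linarith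
  then have "of_int (\<lfloor>real (Suc i) * t\<rfloor> + 1) / real (Suc i) \<le> (real (Suc i) * t + 1) / real (Suc i)"
    by (intro divide_right_mono) auto
  also have "\<dots> = t + inverse (real (Suc i))"
    by (simp add: add_divide_distrib inverse_eq_divide del: of_nat_Suc)
  finally show ?thesis unfolding sample_time_def .
qed

lemma sample_time_tendsto: "(\<lambda>i. sample_time i t) \<longlonglongrightarrow> t"
proof (rule tendsto_sandwich[of "\<lambda>_. t" _ _ "\<lambda>i. t + inverse (real (Suc i))"])
  show "(\<lambda>i. t + inverse (real (Suc i))) \<longlonglongrightarrow> t"
    using LIMSEQ_inverse_real_of_nat_add[of t] .
qed (simp_all add: sample_time_le less_imp_le[OF sample_time_gt] del: of_nat_Suc)

text \<open>The truncation at \<open>t = i + 1\<close> leaves finitely many values and a support of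
  finite measure.\<close>

definition sample_step :: "(real \<Rightarrow> 'b \<Rightarrow> complex) \<Rightarrow> nat \<Rightarrow> real \<Rightarrow> 'b \<Rightarrow> complex" where
  "sample_step G i t = (if t \<le> real (Suc i) then G (sample_time i t) else (\<lambda>_. 0))"

lemma L1_simple_sample_step:
  assumes "\<And>t. 0 < t \<Longrightarrow> integrable M (G t)"
  shows "L1_simple (restrict_space lborel {0<..}) M (sample_step G i)"
proof -
  let ?N = "restrict_space lborel {0::real<..}"
  \<comment> \<open>The index of the sampled grid point, with 0 reserved for the truncated range.
    For \<open>t > 0\<close> grid indices are at least 1, so the two uses do not clash.\<close>
  define k where "k t = (if t \<le> real (Suc i) then \<lfloor>real (Suc i) * t\<rfloor> + 1 else 0)" for t
  define g where "g n = (if n = 0 then (\<lambda>_. 0) else G (of_int n / real (Suc i)))" for n :: int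
  have sp: "space ?N = {0<..}" by (simp add: space_restrict_space)
  have k_bound: "k t \<in> {0..\<lfloor>real (Suc i) * real (Suc i)\<rfloor> + 1}" if "t > 0" for t
    using that by (auto simp: k_def intro!: floor_mono mult_left_mono simp del: of_nat_Suc)
  have "finite (k ` space ?N)"
    by (rule finite_subset[of _ "{0..\<lfloor>real (Suc i) * real (Suc i)\<rfloor> + 1}"]) (use k_bound in \<open>auto simp: sp\<close>)
  moreover have "k \<in> measurable ?N (count_space UNIV)"
    unfolding k_def by (intro measurable_restrict_space1) measurable
  ultimately have "simple_function ?N k" by (simp add: simple_function_eq_measurable)
  then have "simple_function ?N (\<lambda>t. g (k t))" by (rule simple_function_compose1)
  moreover have "g (k t) = sample_step G i t" if "t \<in> space ?N" for t
  proof -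
    have "0 \<le> \<lfloor>real (Suc i) * t\<rfloor>" using that sp by (simp del: of_nat_Suc)
    then have "\<lfloor>real (Suc i) * t\<rfloor> + 1 \<noteq> 0" by linarith
    then show ?thesis by (simp add: g_def k_def sample_step_def sample_time_def del: of_nat_Suc)
  qed
  ultimately have "simple_function ?N (sample_step G i)"
    using simple_function_cong[of ?N "\<lambda>t. g (k t)" "sample_step G i"] by simp
  moreover have "integrable M (sample_step G i t)" if "t \<in> space ?N" for t
    using assms[of "sample_time i t"] that sample_time_gt[of t i] by (auto simp: sample_step_def sp)
  moreover have "emeasure ?N {t \<in> space ?N. sample_step G i t \<noteq> (\<lambda>_. 0)} \<le> emeasure ?N {0<..real (Suc i)}"
    by (intro emeasure_mono) (auto simp: sp sample_step_def sets_restrict_space_iff split: if_splits)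
  moreover have "emeasure ?N {0<..real (Suc i)} < \<infinity>"
    by (subst emeasure_restrict_space) (auto simp del: of_nat_Suc)
  ultimately show ?thesis
    by (auto simp: L1_simple_def)
qed

lemma L1_right_continuous_laplace:
  assumes H: "\<And>t. 0 < t \<Longrightarrow> integrable M (H t)"
    and bound: "\<And>t. 0 < t \<Longrightarrow> (\<integral>x. norm (H t x) \<partial>M) \<le> C"
    and cont: "(\<lambda>i. \<integral>x. norm (H (\<tau> i) x - H t x) \<partial>M) \<longlonglongrightarrow> 0"
    and t: "0 < t" "\<And>i. t < \<tau> i" "\<tau> \<longlonglongrightarrow> t" and s: "Re s > 0"
  shows "(\<lambda>i. \<integral>x. norm (exp (- s * of_real t) * H t x - exp (- s * of_real (\<tau> i)) * H (\<tau> i) x) \<partial>M) \<longlonglongrightarrow> 0"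
proof -
  have \<tau>: "0 < \<tau> i" for i using t(1) t(2)[of i] by linarith
  let ?e = "\<lambda>t. exp (- s * complex_of_real t)"
  have le: "(\<integral>x. norm (?e t * H t x - ?e (\<tau> i) * H (\<tau> i) x) \<partial>M)
      \<le> norm (?e t - ?e (\<tau> i)) * C + (\<integral>x. norm (H (\<tau> i) x - H t x) \<partial>M)" for i
  proof -
    have "(\<integral>x. norm (?e t * H t x - ?e (\<tau> i) * H (\<tau> i) x) \<partial>M)
        \<le> (\<integral>x. norm (?e t - ?e (\<tau> i)) * norm (H t x) + norm (H (\<tau> i) x - H t x) \<partial>M)"
    proof (rule integral_mono)
      fix x
      \<comment> \<open>The change of weight is charged to \<open>H t\<close>, whose norm is at most
        \<open>C\<close>, and the change of function to the weight at \<open>\<tau> i\<close>, which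
        is at most 1 in norm.\<close>
      have "norm (?e t * H t x - ?e (\<tau> i) * H (\<tau> i) x)
          = norm ((?e t - ?e (\<tau> i)) * H t x + ?e (\<tau> i) * (H t x - H (\<tau> i) x))"
        by (simp add: algebra_simps)
      also have "\<dots> \<le> norm ((?e t - ?e (\<tau> i)) * H t x) + norm (?e (\<tau> i) * (H t x - H (\<tau> i) x))"
        by (rule norm_triangle_ineq)
      also have "norm ((?e t - ?e (\<tau> i)) * H t x) = norm (?e t - ?e (\<tau> i)) * norm (H t x)"
        by (rule norm_mult)
      also have "norm (?e (\<tau> i) * (H t x - H (\<tau> i) x)) \<le> norm (H (\<tau> i) x - H t x)"
        using s \<tau>[of i] unfolding norm_mult norm_exp_mult_of_real
        by (intro order_trans[OF mult_left_le_one_le]) (auto simp: norm_minus_commute)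
      finally show "norm (?e t * H t x - ?e (\<tau> i) * H (\<tau> i) x)
          \<le> norm (?e t - ?e (\<tau> i)) * norm (H t x) + norm (H (\<tau> i) x - H t x)" by simp
    qed (use H[OF t(1)] H[OF \<tau>[of i]] in auto)
    also have "\<dots> = norm (?e t - ?e (\<tau> i)) * (\<integral>x. norm (H t x) \<partial>M) + (\<integral>x. norm (H (\<tau> i) x - H t x) \<partial>M)"
      using H[OF t(1)] H[OF \<tau>[of i]] by simp
    also have "\<dots> \<le> norm (?e t - ?e (\<tau> i)) * C + (\<integral>x. norm (H (\<tau> i) x - H t x) \<partial>M)"
      using bound[OF t(1)] by (intro add_mono mult_left_mono) auto
    finally show ?thesis .
  qed
  have "(\<lambda>i. norm (?e t - ?e (\<tau> i)) * C + (\<integral>x. norm (H (\<tau> i) x - H t x) \<partial>M)) \<longlonglongrightarrow> norm (?e t - ?e t) * C + 0"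
    by (intro tendsto_intros cont t)
  then have lim: "(\<lambda>i. norm (?e t - ?e (\<tau> i)) * C + (\<integral>x. norm (H (\<tau> i) x - H t x) \<partial>M)) \<longlonglongrightarrow> 0" by simp
  show ?thesis
    by (rule tendsto_sandwich[OF _ _ tendsto_const lim]) (use le in auto)
qed

text \<open>A criterion for a candidate \<open>I\<close> known only weakly: right continuity of
  \<open>H\<close> supplies simple functions converging in the mean, and duality then forces their
  integrals to converge to \<open>I\<close> in norm.\<close>

lemma has_L1_integral_laplace:
  fixes H :: "real \<Rightarrow> 'b \<Rightarrow> complex"
  defines "N \<equiv> restrict_space lborel {0<..}"
  assumes H: "\<And>t. 0 < t \<Longrightarrow> integrable M (H t)"
    and bound: "\<And>t. 0 < t \<Longrightarrow> (\<integral>x. norm (H t x) \<partial>M) \<le> C"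
    and cont: "\<And>t \<tau>. 0 < t \<Longrightarrow> (\<And>i. t < \<tau> i) \<Longrightarrow> \<tau> \<longlonglongrightarrow> t \<Longrightarrow>
      (\<lambda>i. \<integral>x. norm (H (\<tau> i) x - H t x) \<partial>M) \<longlonglongrightarrow> 0"
    and s: "Re s > 0" and I: "integrable M I"
    and Gw: "\<And>w. unit_test M w \<Longrightarrow> integrable N (\<lambda>t. \<integral>x. exp (- s * of_real t) * H t x * w x \<partial>M)"
    and Iw: "\<And>w. unit_test M w \<Longrightarrow>
      (\<integral>x. I x * w x \<partial>M) = (\<integral>t. (\<integral>x. exp (- s * of_real t) * H t x * w x \<partial>M) \<partial>N)"
  shows "has_L1_integral N M (\<lambda>t x. exp (- s * of_real t) * H t x) I"
proof -
  define G where "G t x = exp (- s * of_real t) * H t x" for t x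
  have sp: "space N = {0<..}" by (simp add: N_def space_restrict_space)
  have G: "integrable M (G t)" if "0 < t" for t
    unfolding G_def using H[OF that] by simp
  define S where "S = sample_step G"
  have S: "L1_simple N M (S i)" for i
    unfolding N_def S_def by (rule L1_simple_sample_step[OF G])
  have Sint: "integrable M (S i t)" if "0 < t" for i t
    using S[of i] that by (auto simp: L1_simple_def sp)
  have "0 \<le> C"
    using bound[of 1] by (rule order_trans[rotated]) auto
  have Gbound: "(\<integral>x. norm (G t x) \<partial>M) \<le> C * exp (- Re s * t)" if "0 < t" for t
    using bound[OF that] by (simp add: G_def norm_mult mult.commute)
  \<comment> \<open>Sampling happens at a later time, where the exponential weight is smaller, so
    the bound at \<open>t\<close> also dominates the sampled function.\<close>
  have Sbound: "(\<integral>x. norm (S i t x) \<partial>M) \<le> C * exp (- Re s * t)" if "0 < t" for i t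
  proof (cases "t \<le> real (Suc i)")
    case True
    have gt: "t < sample_time i t" by (rule sample_time_gt)
    then have "(\<integral>x. norm (S i t x) \<partial>M) \<le> C * exp (- Re s * sample_time i t)"
      using Gbound[of "sample_time i t"] that True by (simp add: S_def sample_step_def)
    also have "\<dots> \<le> C * exp (- Re s * t)"
      using \<open>0 \<le> C\<close> gt s by (intro mult_left_mono) auto
    finally show ?thesis .
  qed (use \<open>0 \<le> C\<close> in \<open>simp add: S_def sample_step_def\<close>)
  define d where "d i t = (\<integral>x. norm (G t x - S i t x) \<partial>M)" for i t
  have dist: "L1_dist M (G t) (S i t) = ennreal (d i t)" if "0 < t" for i t
    unfolding d_def by (rule L1_dist_eq_integral[OF G[OF that] Sint[OF that]])
  have d_lim: "(\<lambda>i. d i t) \<longlonglongrightarrow> 0" if t: "0 < t" for t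
  proof (rule Lim_transform_eventually)
    show "(\<lambda>i. \<integral>x. norm (G t x - G (sample_time i t) x) \<partial>M) \<longlonglongrightarrow> 0"
      unfolding G_def
      by (rule L1_right_continuous_laplace[OF H bound cont])
        (use t s in \<open>auto simp: sample_time_gt sample_time_tendsto\<close>)
    have "\<forall>\<^sub>F i in sequentially. t \<le> real (Suc i)"
      unfolding eventually_sequentially by (rule exI[of _ "nat \<lceil>t\<rceil>"]) linarith
    then show "\<forall>\<^sub>F i in sequentially. (\<integral>x. norm (G t x - G (sample_time i t) x) \<partial>M) = d i t"
      by eventually_elim (simp add: d_def S_def sample_step_def)
  qed
  have d_bound: "d i t \<le> 2 * C * exp (- Re s * t)" if "0 < t" for i t
  proof -
    have "d i t \<le> (\<integral>x. norm (G t x) + norm (S i t x) \<partial>M)"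
      unfolding d_def using G[OF that] Sint[OF that] by (intro integral_mono) (auto intro: norm_triangle_ineq4)
    also have "\<dots> = (\<integral>x. norm (G t x) \<partial>M) + (\<integral>x. norm (S i t x) \<partial>M)"
      using G[OF that] Sint[OF that] by simp
    finally show ?thesis using Gbound[OF that] Sbound[OF that, of i] by simp
  qed
  \<comment> \<open>No measurability of \<open>G\<close> in \<open>t\<close> is at hand. Replacing
    \<open>G t\<close> by \<open>S j t\<close> makes the distance a simple function of
    \<open>t\<close>, and these distances converge to \<open>d i t\<close> as \<open>j\<close>
    grows.\<close>
  have d_meas: "(\<lambda>t. d i t) \<in> borel_measurable N" for i
  proof (rule borel_measurable_LIMSEQ_real)
    fix j
    have "simple_function N (S j)" "simple_function N (S i)" using S by (auto simp: L1_simple_def)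
    from simple_function_compose2[OF this, of "\<lambda>f g. \<integral>x. norm (f x - g x) \<partial>M"]
    show "(\<lambda>t. \<integral>x. norm (S j t x - S i t x) \<partial>M) \<in> borel_measurable N"
      by (rule borel_measurable_simple_function)
  next
    fix t assume "t \<in> space N"
    then have t: "0 < t" by (simp add: sp)
    show "(\<lambda>j. \<integral>x. norm (S j t x - S i t x) \<partial>M) \<longlonglongrightarrow> d i t"
    proof (rule LIM_zero_cancel, rule tendsto_rabs_zero_cancel, rule tendsto_sandwich[OF _ _ tendsto_const d_lim[OF t]])
      have "\<bar>(\<integral>x. norm (S j t x - S i t x) \<partial>M) - d i t\<bar> \<le> d j t" for j
      proof -
        have "\<bar>(\<integral>x. norm (S j t x - S i t x) \<partial>M) - d i t\<bar>
            = \<bar>\<integral>x. norm (S j t x - S i t x) - norm (G t x - S i t x) \<partial>M\<bar>"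
          unfolding d_def using G[OF t] Sint[OF t] by simp
        also have "\<dots> \<le> (\<integral>x. \<bar>norm (S j t x - S i t x) - norm (G t x - S i t x)\<bar> \<partial>M)"
          by (rule integral_abs_bound)
        also have "\<dots> \<le> d j t"
          unfolding d_def
        proof (rule integral_mono)
          show "\<bar>norm (S j t x - S i t x) - norm (G t x - S i t x)\<bar> \<le> norm (G t x - S j t x)" for x
            using norm_triangle_ineq3[of "S j t x - S i t x" "G t x - S i t x"]
            by (simp add: norm_minus_commute)
        qed (use G[OF t] Sint[OF t] in auto)
        finally show ?thesis .
      qed
      then show "\<forall>\<^sub>F j in sequentially. \<bar>(\<integral>x. norm (S j t x - S i t x) \<partial>M) - d i t\<bar> \<le> d j t" by simp
    qed simp
  qed
  have ennlim: "(\<lambda>i. ennreal (d i t)) \<longlonglongrightarrow> 0" if "0 < t" for t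
    using tendsto_ennrealI[OF d_lim[OF that]] by simp
  have "(\<lambda>i. \<integral>\<^sup>+ t. ennreal (d i t) \<partial>N) \<longlonglongrightarrow> (\<integral>\<^sup>+ t. 0 \<partial>N)"
  proof (rule nn_integral_dominated_convergence[where w = "\<lambda>t. ennreal (2 * C * exp (- Re s * t))"])
    show "(\<lambda>t. ennreal (2 * C * exp (- Re s * t))) \<in> borel_measurable N"
      unfolding N_def by (intro measurable_restrict_space1) measurable
    have "integrable N (\<lambda>t. 2 * C * exp (- Re s * t))"
      using integrable_I0i_exp_mscale[OF s]
      by (simp add: N_def integrable_restrict_space set_integrable_def mult.commute)
    then show "(\<integral>\<^sup>+ t. ennreal (2 * C * exp (- Re s * t)) \<partial>N) < \<infinity>"
      using \<open>0 \<le> C\<close> by (subst nn_integral_eq_integral) auto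
    show "AE t in N. ennreal (d i t) \<le> ennreal (2 * C * exp (- Re s * t))" for i
      using d_bound by (intro AE_I2 ennreal_leI) (auto simp: sp)
    show "AE t in N. (\<lambda>i. ennreal (d i t)) \<longlonglongrightarrow> 0"
      using ennlim by (intro AE_I2) (simp add: sp)
  qed (use d_meas in auto)
  moreover have "(\<integral>\<^sup>+ t. L1_dist M (G t) (S i t) \<partial>N) = (\<integral>\<^sup>+ t. ennreal (d i t) \<partial>N)" for i
    by (intro nn_integral_cong dist) (simp add: sp)
  ultimately have mean: "(\<lambda>i. \<integral>\<^sup>+ t. L1_dist M (G t) (S i t) \<partial>N) \<longlonglongrightarrow> 0" by simp
  have "L1_dist M (L1_simple_integral N (S i)) I \<le> (\<integral>\<^sup>+ t. L1_dist M (G t) (S i t) \<partial>N)" for i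
  proof -
    let ?J = "L1_simple_integral N (S i)"
    have J: "integrable M ?J" by (rule integrable_L1_simple_integral[OF S])
    then have JI: "integrable M (\<lambda>x. ?J x - I x)" using I by simp
    \<comment> \<open>The test function attaining the norm depends on \<open>i\<close>; this is
      harmless, as the error bound below is uniform over all unit tests.\<close>
    obtain w where w: "unit_test M w"
      "(\<integral>x. (?J x - I x) * w x \<partial>M) = complex_of_real (\<integral>x. norm (?J x - I x) \<partial>M)"
      using unit_test_attains_norm[OF JI] .
    have "L1_dist M ?J I = ennreal (norm (\<integral>x. (?J x - I x) * w x \<partial>M))"
      using w(2) by (simp add: L1_dist_eq_integral[OF J I])
    also have "(\<integral>x. (?J x - I x) * w x \<partial>M) = (\<integral>x. ?J x * w x \<partial>M) - (\<integral>t. (\<integral>x. G t x * w x \<partial>M) \<partial>N)"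
      using integrable_mult_Linf[OF J unit_test_Linf[OF w(1)]] integrable_mult_Linf[OF I unit_test_Linf[OF w(1)]]
      by (simp add: left_diff_distrib Iw[OF w(1)] G_def)
    also have "ennreal (norm \<dots>) \<le> (\<integral>\<^sup>+ t. L1_dist M (G t) (S i t) \<partial>N)"
      using G Gw[OF w(1), folded G_def] by (intro L1_simple_integral_dual_error[OF S w(1)]) (auto simp: sp)
    finally show ?thesis .
  qed
  then have "(\<lambda>i. L1_dist M (L1_simple_integral N (S i)) I) \<longlonglongrightarrow> 0"
    by (intro tendsto_sandwich[OF _ _ tendsto_const mean]) auto
  moreover have "AE t in N. (\<lambda>i. L1_dist M (G t) (S i t)) \<longlonglongrightarrow> 0"
    using ennlim dist by (intro AE_I2) (simp add: sp)
  ultimately have "has_L1_integral N M G I"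
    unfolding has_L1_integral_def using G I S mean by (intro conjI exI[of _ S]) (auto simp: sp)
  then show ?thesis by (simp add: G_def[abs_def])
qed

section \<open>The suspension semiflow\<close>

lemma birkhoff_sum_0 [simp]: "birkhoff_sum F \<phi> 0 y = 0"
  by (simp add: birkhoff_sum_def)

lemma birkhoff_sum_Suc: "birkhoff_sum F \<phi> (Suc n) y = birkhoff_sum F \<phi> n y + \<phi> ((F ^^ n) y)"
  by (simp add: birkhoff_sum_def)

lemma birkhoff_sum_add:
  "birkhoff_sum F \<phi> (n + m) y = birkhoff_sum F \<phi> n y + birkhoff_sum F \<phi> m ((F ^^ n) y)"
proof (induction m)
  case (Suc m)
  have "(F ^^ (n + m)) y = (F ^^ m) ((F ^^ n) y)" by (subst add.commute) (simp add: funpow_add)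
  with Suc show ?case by (simp add: birkhoff_sum_Suc)
qed simp

locale suspension = prob_space M for M :: "'a measure" +
  fixes F :: "'a \<Rightarrow> 'a" and \<phi> :: "'a \<Rightarrow> real"
  assumes F_measurable [measurable]: "F \<in> measurable M M"
    and distr_F: "distr M M F = M"
    and roof_measurable [measurable]: "\<phi> \<in> borel_measurable M"
    and roof_gt_2: "\<And>y. y \<in> space M \<Longrightarrow> 2 < \<phi> y"
begin

abbreviation cyl :: "('a \<times> real) measure" where
  "cyl \<equiv> M \<Otimes>\<^sub>M lborel"

abbreviation flow :: "real \<Rightarrow> 'a \<times> real \<Rightarrow> 'a \<times> real" where
  "flow \<equiv> susp_flow F \<phi>"

lemma F_space: "y \<in> space M \<Longrightarrow> F y \<in> space M"
  using measurable_space[OF F_measurable] .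

lemma funpow_measurable [measurable]: "F ^^ n \<in> measurable M M"
  by (induction n) (auto simp: measurable_ident intro: measurable_comp)

lemma funpow_space: "y \<in> space M \<Longrightarrow> (F ^^ n) y \<in> space M"
  using measurable_space[OF funpow_measurable] .

lemma distr_funpow: "distr M M (F ^^ n) = M"
proof (induction n)
  case 0
  then show ?case by (simp add: distr_id id_def)
next
  case (Suc n)
  have "distr M M (F ^^ Suc n) = distr (distr M M (F ^^ n)) M F"
    by (simp add: distr_distr comp_def)
  with Suc show ?case by (simp add: distr_F comp_def)
qed

lemma birkhoff_sum_measurable [measurable]: "birkhoff_sum F \<phi> n \<in> borel_measurable M"
  unfolding birkhoff_sum_def[abs_def] by measurable

lemma birkhoff_sum_less_Suc: "y \<in> space M \<Longrightarrow> birkhoff_sum F \<phi> n y < birkhoff_sum F \<phi> (Suc n) y"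
  using roof_gt_2[OF funpow_space, of y n] by (simp add: birkhoff_sum_Suc)

lemma birkhoff_sum_strict_mono: "y \<in> space M \<Longrightarrow> strict_mono (\<lambda>n. birkhoff_sum F \<phi> n y)"
  by (rule strict_mono_Suc_iff[THEN iffD2]) (simp add: birkhoff_sum_less_Suc)

lemma birkhoff_sum_ge: "y \<in> space M \<Longrightarrow> 2 * real n \<le> birkhoff_sum F \<phi> n y"
proof (induction n)
  case (Suc n)
  then show ?case using roof_gt_2[OF funpow_space[OF Suc.prems], of n] by (simp add: birkhoff_sum_Suc)
qed simp

text \<open>Replaces the \<open>LEAST\<close> in the flow by a two-sided bracket; strict growth of
  the Birkhoff sums makes the bracketing index unique.\<close>

lemma flow_eqI:
  assumes y: "y \<in> space M" and n: "birkhoff_sum F \<phi> n y \<le> u + t" "u + t < birkhoff_sum F \<phi> (Suc n) y"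
  shows "flow t (y, u) = ((F ^^ n) y, u + t - birkhoff_sum F \<phi> n y)"
proof -
  have "(LEAST n. u + t < birkhoff_sum F \<phi> (Suc n) y) = n"
  proof (rule Least_equality[where P = "\<lambda>n. u + t < birkhoff_sum F \<phi> (Suc n) y"])
    fix m assume "u + t < birkhoff_sum F \<phi> (Suc m) y"
    with n(1) have "birkhoff_sum F \<phi> n y < birkhoff_sum F \<phi> (Suc m) y" by linarith
    then show "n \<le> m"
      using strict_mono_less[OF birkhoff_sum_strict_mono[OF y], of n "Suc m"] by simp
  qed (rule n)
  then show ?thesis by (simp add: susp_flow_def)
qed

lemma flow_cases:
  assumes y: "y \<in> space M" and "0 \<le> u + t"
  obtains n where "birkhoff_sum F \<phi> n y \<le> u + t" "u + t < birkhoff_sum F \<phi> (Suc n) y"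
proof -
  define P where "P n \<longleftrightarrow> u + t < birkhoff_sum F \<phi> (Suc n) y" for n
  define n where "n = (LEAST n. P n)"
  obtain m :: nat where "u + t < real m" using reals_Archimedean2 by blast
  then have "P m"
    using birkhoff_sum_ge[OF y, of "Suc m"] by (simp add: P_def)
  then have n: "P n" unfolding n_def by (rule LeastI)
  \<comment> \<open>For a positive index this is minimality, since the preceding index fails; for
    index 0 it is the assumption on \<open>u + t\<close>.\<close>
  have "birkhoff_sum F \<phi> n y \<le> u + t"
  proof (cases n)
    case (Suc k)
    then have "\<not> P k" using not_less_Least[of k P] by (simp add: n_def)
    then show ?thesis using Suc by (simp add: P_def)
  qed (use assms(2) in simp)
  with n show ?thesis using that by (simp add: P_def)
qed

lemma flow_in_susp:
  assumes "p \<in> susp M \<phi>" "0 \<le> t"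
  shows "flow t p \<in> susp M \<phi>"
proof -
  obtain y u where p: "p = (y, u)" "y \<in> space M" "0 \<le> u" using assms by (auto simp: susp_def)
  with assms(2) have "0 \<le> u + t" by simp
  from flow_cases[OF p(2) this] obtain n where
    n: "birkhoff_sum F \<phi> n y \<le> u + t" "u + t < birkhoff_sum F \<phi> (Suc n) y" .
  then show ?thesis
    using funpow_space[OF p(2)] by (auto simp: p(1) flow_eqI[OF p(2) n] susp_def birkhoff_sum_Suc)
qed

text \<open>By the cocycle identity for Birkhoff sums, the indices of the two successive moves add
  up to the index of the combined one.\<close>

lemma flow_add:
  assumes "p \<in> susp M \<phi>" "0 \<le> s" "0 \<le> t"
  shows "flow t (flow s p) = flow (s + t) p"
proof -
  obtain y u where p: "p = (y, u)" "y \<in> space M" "0 \<le> u" using assms by (auto simp: susp_def)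
  with assms(2) have "0 \<le> u + s" by simp
  from flow_cases[OF p(2) this] obtain n where
    n: "birkhoff_sum F \<phi> n y \<le> u + s" "u + s < birkhoff_sum F \<phi> (Suc n) y" .
  have z: "(F ^^ n) y \<in> space M" by (rule funpow_space[OF p(2)])
  have "0 \<le> (u + s - birkhoff_sum F \<phi> n y) + t" using n assms(3) by simp
  from flow_cases[OF z this] obtain m where
    m: "birkhoff_sum F \<phi> m ((F ^^ n) y) \<le> (u + s - birkhoff_sum F \<phi> n y) + t"
      "(u + s - birkhoff_sum F \<phi> n y) + t < birkhoff_sum F \<phi> (Suc m) ((F ^^ n) y)" .
  have nm: "birkhoff_sum F \<phi> (n + m) y \<le> u + (s + t)" "u + (s + t) < birkhoff_sum F \<phi> (Suc (n + m)) y"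
    using m birkhoff_sum_add[of F \<phi> n m y] birkhoff_sum_add[of F \<phi> n "Suc m" y] by auto
  have "(F ^^ (n + m)) y = (F ^^ m) ((F ^^ n) y)" by (subst add.commute) (simp add: funpow_add)
  then show ?thesis
    using birkhoff_sum_add[of F \<phi> n m y]
    by (simp add: p(1) flow_eqI[OF p(2) n] flow_eqI[OF z m] flow_eqI[OF p(2) nm])
qed

text \<open>The heights \<open>u + t + \<phi> y\<close> over \<open>y\<close> and
  \<open>u + t\<close> over \<open>F y\<close> describe the same point of the quotient, so starting
  from \<open>y\<close> costs exactly one more identification. This is the dynamical content of the
  renewal equation.\<close>

lemma flow_renewal:
  assumes y: "y \<in> space M" and u: "0 \<le> u" and t: "0 \<le> t"
  shows "flow (t + \<phi> y) (y, u) = flow t (F y, u)"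
proof -
  have Fy: "F y \<in> space M" by (rule F_space[OF y])
  have "0 \<le> u + t" using u t by simp
  from flow_cases[OF Fy this] obtain n where
    n: "birkhoff_sum F \<phi> n (F y) \<le> u + t" "u + t < birkhoff_sum F \<phi> (Suc n) (F y)" .
  have B: "birkhoff_sum F \<phi> (Suc k) y = \<phi> y + birkhoff_sum F \<phi> k (F y)" for k
    using birkhoff_sum_add[of F \<phi> 1 k y] by (simp add: birkhoff_sum_Suc)
  have "birkhoff_sum F \<phi> (Suc n) y \<le> u + (t + \<phi> y)" "u + (t + \<phi> y) < birkhoff_sum F \<phi> (Suc (Suc n)) y"
    using n by (auto simp: B)
  from flow_eqI[OF y this] show ?thesis
    by (simp add: flow_eqI[OF Fy n] B funpow_swap1)
qed

text \<open>The height stays at most 2, hence below the roof, and no identification occurs.\<close>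

lemma flow_short:
  assumes "y \<in> space M" "0 \<le> u" "u \<le> 1" "0 \<le> t" "t \<le> 1"
  shows "flow t (y, u) = (y, u + t)"
  using flow_eqI[OF assms(1), of 0 u t] assms roof_gt_2[OF assms(1)] by (simp add: birkhoff_sum_Suc)

text \<open>The number of identifications is a measurable function into the naturals, and for each
  fixed number the flow is given by an explicit measurable formula.\<close>

lemma flow_measurable [measurable]:
  "(\<lambda>(t, p). flow t p) \<in> measurable (lborel \<Otimes>\<^sub>M cyl) cyl"
proof -
  let ?P = "lborel \<Otimes>\<^sub>M cyl :: (real \<times> ('a \<times> real)) measure"
  have [measurable]: "(\<lambda>q. LEAST n. snd (snd q) + fst q < birkhoff_sum F \<phi> (Suc n) (fst (snd q)))
      \<in> measurable ?P (count_space UNIV)"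
    by measurable
  have "(\<lambda>q. (\<lambda>n q. ((F ^^ n) (fst (snd q)), snd (snd q) + fst q - birkhoff_sum F \<phi> n (fst (snd q))))
       (LEAST n. snd (snd q) + fst q < birkhoff_sum F \<phi> (Suc n) (fst (snd q))) q)
     \<in> measurable ?P cyl"
    by (rule measurable_compose_countable) measurable
  also have "(\<lambda>q. (\<lambda>n q. ((F ^^ n) (fst (snd q)), snd (snd q) + fst q - birkhoff_sum F \<phi> n (fst (snd q))))
       (LEAST n. snd (snd q) + fst q < birkhoff_sum F \<phi> (Suc n) (fst (snd q))) q) = (\<lambda>(t, p). flow t p)"
    by (auto simp: susp_flow_def Let_def)
  finally show ?thesis .
qed

lemma flow_measurable_fixed [measurable]: "flow t \<in> measurable cyl cyl"
  using measurable_compose[OF measurable_Pair1'[of t lborel] flow_measurable] by simp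

text \<open>On each fibre Lebesgue measure absorbs the shift by \<open>g\<close>; invariance of
  \<open>M\<close> under \<open>f\<close> then takes care of the base.\<close>

lemma distr_skew_translation:
  fixes g :: "'a \<Rightarrow> real"
  assumes f: "f \<in> measurable M M" "distr M M f = M" and g[measurable]: "g \<in> borel_measurable M"
  shows "distr cyl cyl (\<lambda>p. (f (fst p), snd p + g (fst p))) = cyl"
    (is "distr ?P ?P ?h = _")
proof (rule measure_eqI)
  note f(1)[measurable]
  fix E :: "('a \<times> real) set" assume "E \<in> sets (distr ?P ?P ?h)"
  then have E[measurable]: "E \<in> sets ?P" by simp
  let ?A = "?h -` E \<inter> space ?P"
  have A: "?A \<in> sets ?P" by measurable
  have "emeasure (distr ?P ?P ?h) E = emeasure ?P ?A"
    by (rule emeasure_distr) measurable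
  also have "\<dots> = (\<integral>\<^sup>+ y. emeasure lborel (Pair y -` ?A) \<partial>M)"
    by (rule lborel.emeasure_pair_measure_alt[OF A])
  also have "\<dots> = (\<integral>\<^sup>+ y. emeasure lborel (Pair (f y) -` E) \<partial>M)"
  proof (rule nn_integral_cong)
    fix y assume y: "y \<in> space M"
    have "Pair (f y) -` E \<in> sets (lborel :: real measure)" by (rule sets_Pair1) measurable
    then have [measurable]: "Pair (f y) -` E \<in> sets borel" by simp
    have "emeasure lborel (Pair (f y) -` E) = emeasure (distr lborel borel ((+) (g y))) (Pair (f y) -` E)"
      by (simp add: lborel_distr_plus)
    also have "\<dots> = emeasure lborel ((+) (g y) -` (Pair (f y) -` E) \<inter> space lborel)"
      by (rule emeasure_distr) auto
    also have "(+) (g y) -` (Pair (f y) -` E) \<inter> space lborel = Pair y -` ?A"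
      using y by (auto simp: space_pair_measure add.commute)
    finally show "emeasure lborel (Pair y -` ?A) = emeasure lborel (Pair (f y) -` E)" by simp
  qed
  also have "\<dots> = (\<integral>\<^sup>+ y. emeasure lborel (Pair y -` E) \<partial>distr M M f)"
    by (rule nn_integral_distr[symmetric]) measurable
  also have "\<dots> = emeasure ?P E"
    by (simp add: f(2) lborel.emeasure_pair_measure_alt[OF E])
  finally show "emeasure (distr ?P ?P ?h) E = emeasure ?P E" .
qed simp

lemma skew_translation_null_set:
  assumes E: "E \<in> null_sets cyl"
    and f: "f \<in> measurable M M" "distr M M f = M" and g: "g \<in> borel_measurable M"
  shows "(\<lambda>p. (f (fst p), snd p + g (fst p))) -` E \<inter> space cyl \<in> null_sets cyl"
proof -
  note f(1)[measurable] g[measurable]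
  have "E \<in> null_sets (distr cyl cyl (\<lambda>p. (f (fst p), snd p + g (fst p))))"
    using E by (simp add: distr_skew_translation[OF f g])
  then show ?thesis
    by (subst (asm) null_sets_distr_iff) auto
qed

text \<open>Whatever index the flow selects at a point, it acts there as one of countably many skew
  translations, each preserving the product measure. The preimage of a null set is thus covered by
  countably many null sets.\<close>

lemma flow_null_reflecting_product: "null_reflecting cyl cyl (flow t)"
  unfolding null_reflecting_def
proof (intro conjI ballI)
  fix E :: "('a \<times> real) set" assume E: "E \<in> null_sets cyl"
  let ?B = "\<lambda>n. (\<lambda>p. ((F ^^ n) (fst p), snd p + (t - birkhoff_sum F \<phi> n (fst p)))) -` E \<inter> space cyl"
  have B: "?B n \<in> null_sets cyl" for n
    by (rule skew_translation_null_set[OF E funpow_measurable distr_funpow]) measurable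
  have "flow t -` E \<inter> space cyl \<subseteq> (\<Union>n. ?B n)"
    by (auto simp: susp_flow_def Let_def add_diff_eq)
  moreover have "(\<Union>n. ?B n) \<in> null_sets cyl" using B by (intro null_sets_UN) auto
  moreover have "flow t -` E \<inter> space cyl \<in> sets cyl"
    using E by (intro measurable_sets[OF flow_measurable_fixed]) auto
  ultimately show "flow t -` E \<inter> space cyl \<in> null_sets cyl"
    using null_sets_subset by blast
qed (rule flow_measurable_fixed)


section \<open>The operators on the suspension\<close>

lemma pair_sigma_finite_cyl: "pair_sigma_finite M (lborel :: real measure)"
  by (simp add: pair_sigma_finite_def sigma_finite_measure_axioms lborel.sigma_finite_measure_axioms)

lemma sigma_finite_cyl: "sigma_finite_measure cyl"
  by (intro sigma_finite_pair_measure sigma_finite_measure_axioms lborel.sigma_finite_measure_axioms)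

lemma Ytil_sets [measurable]: "Ytil M \<in> sets cyl"
  unfolding Ytil_def by measurable

lemma susp_sets [measurable]: "susp M \<phi> \<in> sets cyl"
proof -
  have "susp M \<phi> = {p \<in> space cyl. 0 \<le> snd p \<and> snd p < \<phi> (fst p)}"
    by (auto simp: susp_def space_pair_measure)
  moreover have "{p \<in> space cyl. 0 \<le> snd p \<and> snd p < \<phi> (fst p)} \<in> sets cyl" by measurable
  ultimately show ?thesis by (simp only:)
qed

lemma Ytil_Int_sets: "Ytil M \<inter> space cyl \<in> sets cyl"
  and susp_Int_sets: "susp M \<phi> \<inter> space cyl \<in> sets cyl"
  by (intro sets.Int Ytil_sets susp_sets sets.top)+

lemma Ytil_subset_susp: "Ytil M \<subseteq> susp M \<phi>"
  using roof_gt_2 by (fastforce simp: Ytil_def susp_def)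

text \<open>Puts the measure on \<open>Ytil\<close> inside the same product space as the suspension,
  so that functions on both can be compared after extension by zero.\<close>

lemma mutil_eq_restrict: "mutil M = restrict_space cyl (Ytil M)"
  unfolding mutil_def
proof (rule pair_measure_eqI)
  let ?L = "restrict_space lborel {0..1} :: real measure"
  show "sigma_finite_measure ?L"
    by (rule sigma_finite_measure_restrict_space) (auto simp: lborel.sigma_finite_measure_axioms)
  have 1: "(\<lambda>p. (fst p, snd p)) \<in> measurable (restrict_space cyl (Ytil M)) (M \<Otimes>\<^sub>M ?L)"
    by (intro measurable_Pair measurable_restrict_space1 measurable_fst measurable_restrict_space2)
      (auto simp: space_restrict_space Ytil_def)
  have id: "(\<lambda>x. x) \<in> measurable ?L lborel" by (intro measurable_restrict_space1) simp
  have 2: "(\<lambda>p. (fst p, snd p)) \<in> measurable (M \<Otimes>\<^sub>M ?L) (restrict_space cyl (Ytil M))"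
  proof (rule measurable_restrict_space2)
    show "(\<lambda>p. (fst p, snd p)) \<in> measurable (M \<Otimes>\<^sub>M ?L) cyl"
      using measurable_compose[OF measurable_snd id] by (intro measurable_Pair measurable_fst)
  qed (auto simp: space_pair_measure space_restrict_space Ytil_def)
  have sp: "space (M \<Otimes>\<^sub>M ?L) = space (restrict_space cyl (Ytil M))"
    by (auto simp: space_pair_measure space_restrict_space Ytil_def)
  show "sets (M \<Otimes>\<^sub>M ?L) = sets (restrict_space cyl (Ytil M))"
  proof (intro equalityI subsetI)
    fix A assume A: "A \<in> sets (M \<Otimes>\<^sub>M ?L)"
    then show "A \<in> sets (restrict_space cyl (Ytil M))"
      using measurable_sets[OF 1 A] sets.sets_into_space[OF A] sp by (simp add: Int_absorb2)
  next
    fix A assume A: "A \<in> sets (restrict_space cyl (Ytil M))"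
    then show "A \<in> sets (M \<Otimes>\<^sub>M ?L)"
      using measurable_sets[OF 2 A] sets.sets_into_space[OF A] sp by (simp add: Int_absorb2)
  qed
  fix A :: "'a set" and B :: "real set" assume A: "A \<in> sets M" and B: "B \<in> sets ?L"
  then have B': "B \<in> sets lborel" "B \<subseteq> {0..1}" by (auto simp: sets_restrict_space)
  then show "emeasure M A * emeasure ?L B = emeasure (restrict_space cyl (Ytil M)) (A \<times> B)"
    using A sets.sets_into_space[OF A]
    by (subst emeasure_restrict_space[OF Ytil_Int_sets], force simp: Ytil_def)
      (simp add: emeasure_restrict_space lborel.emeasure_pair_measure_Times)
qed (rule sigma_finite_measure_axioms)

lemma space_mutil: "space (mutil M) = Ytil M"
  by (auto simp: mutil_eq_restrict space_restrict_space Ytil_def space_pair_measure)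

lemma finite_measure_mutil: "finite_measure (mutil M)"
proof
  have "emeasure (mutil M) (space (mutil M)) = emeasure cyl (space M \<times> {0..1})"
    by (subst space_mutil, subst mutil_eq_restrict, subst emeasure_restrict_space[OF Ytil_Int_sets])
      (auto simp: Ytil_def)
  also have "\<dots> = 1"
    by (simp add: lborel.emeasure_pair_measure_Times emeasure_space_1)
  finally show "emeasure (mutil M) (space (mutil M)) \<noteq> \<infinity>" by simp
qed

section \<open>Extension by zero and normalisation of the suspension measure\<close>

definition zext :: "('a \<times> real \<Rightarrow> complex) \<Rightarrow> 'a \<times> real \<Rightarrow> complex" where
  "zext w p = indicator (Ytil M) p * w p"

lemma zext_eq_scaleR: "zext w p = indicator (Ytil M) p *\<^sub>R w p"
  by (simp add: zext_def indicator_def)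

lemma zext_measurable: "w \<in> borel_measurable (mutil M) \<Longrightarrow> zext w \<in> borel_measurable cyl"
  by (simp add: mutil_eq_restrict borel_measurable_restrict_space_iff[OF Ytil_Int_sets] zext_eq_scaleR[abs_def])

lemma zext_unit_test: "unit_test (mutil M) w \<Longrightarrow> unit_test cyl (zext w)"
  by (auto simp: unit_test_def zext_measurable) (auto simp: zext_def indicator_def)

lemma integrable_mutil_iff: "integrable (mutil M) f \<longleftrightarrow> integrable cyl (zext f)"
  by (simp add: mutil_eq_restrict integrable_restrict_space[OF Ytil_Int_sets] zext_eq_scaleR[abs_def])

lemma integral_mutil: "(\<integral>p. f p \<partial>mutil M) = (\<integral>p. zext f p \<partial>cyl)"
  by (simp add: mutil_eq_restrict integral_restrict_space[OF Ytil_Int_sets] zext_eq_scaleR)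

lemma susp_measure_density:
  obtains c where "0 < c"
    "susp_measure M \<phi> = density (restrict_space cyl (susp M \<phi>)) (\<lambda>_. ennreal c)"
proof -
  define c where "c = (if integrable M \<phi> then 1 / (\<integral>y. \<phi> y \<partial>M) else 1)"
  \<comment> \<open>Positivity of the normalising integral; otherwise \<open>1 / 0 = 0\<close> would
    make the suspension measure trivial.\<close>
  have "2 \<le> (\<integral>y. \<phi> y \<partial>M)" if "integrable M \<phi>"
    using roof_gt_2 that by (intro integral_ge_const) (auto intro!: AE_I2 less_imp_le)
  then have "0 < c" by (fastforce simp: c_def)
  moreover have "susp_measure M \<phi> = scale_measure (ennreal c) (restrict_space cyl (susp M \<phi>))"
    by (simp add: susp_measure_def c_def Let_def)
  moreover have "\<dots> = density (restrict_space cyl (susp M \<phi>)) (\<lambda>_. ennreal c)"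
    by (rule measure_eqI) (auto simp: emeasure_density_const)
  ultimately show ?thesis using that by simp
qed

lemma sets_susp_measure: "sets (susp_measure M \<phi>) = sets (restrict_space cyl (susp M \<phi>))"
  by (rule susp_measure_density) simp

lemma space_susp_measure: "space (susp_measure M \<phi>) = susp M \<phi>"
  using sets_eq_imp_space_eq[OF sets_susp_measure]
  by (auto simp: space_restrict_space susp_def space_pair_measure)

lemma null_sets_susp_measure:
  "E \<in> null_sets (susp_measure M \<phi>) \<longleftrightarrow> E \<subseteq> susp M \<phi> \<and> E \<in> null_sets cyl"
proof (rule susp_measure_density)
  fix c assume c: "0 < c" "susp_measure M \<phi> = density (restrict_space cyl (susp M \<phi>)) (\<lambda>_. ennreal c)"
  have "E \<in> null_sets (susp_measure M \<phi>) \<longleftrightarrow> E \<in> null_sets (restrict_space cyl (susp M \<phi>))"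
    unfolding c(2) using c(1) by (auto simp: null_sets_def emeasure_density_const)
  then show ?thesis by (simp only: null_sets_restrict_space[OF susp_sets])
qed

lemma sigma_finite_susp_measure: "sigma_finite_measure (susp_measure M \<phi>)"
proof (rule susp_measure_density)
  fix c assume c: "susp_measure M \<phi> = density (restrict_space cyl (susp M \<phi>)) (\<lambda>_. ennreal c)"
  interpret R: sigma_finite_measure "restrict_space cyl (susp M \<phi>)"
    by (rule sigma_finite_measure_restrict_space[OF sigma_finite_cyl susp_sets])
  show ?thesis unfolding c by (subst R.sigma_finite_iff_density_finite) auto
qed

lemma flow_null_reflecting:
  assumes t: "0 \<le> t"
  shows "null_reflecting (susp_measure M \<phi>) (susp_measure M \<phi>) (flow t)"
  unfolding null_reflecting_def
proof (intro conjI ballI)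
  have "flow t \<in> measurable (restrict_space cyl (susp M \<phi>)) (restrict_space cyl (susp M \<phi>))"
    using flow_in_susp[OF _ t]
    by (intro measurable_restrict_space2 measurable_restrict_space1 flow_measurable_fixed)
      (auto simp: space_restrict_space)
  then show meas: "flow t \<in> measurable (susp_measure M \<phi>) (susp_measure M \<phi>)"
    by (simp add: measurable_cong_sets[OF sets_susp_measure sets_susp_measure])
  fix E assume "E \<in> null_sets (susp_measure M \<phi>)"
  then have "E \<in> null_sets cyl" by (simp add: null_sets_susp_measure)
  then have "flow t -` E \<inter> space cyl \<in> null_sets cyl"
    using flow_null_reflecting_product[of t] by (simp add: null_reflecting_def)
  then have "(flow t -` E \<inter> space cyl) \<inter> susp M \<phi> \<in> null_sets cyl"
    by (rule null_set_Int2[OF _ susp_sets])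
  moreover have "(flow t -` E \<inter> space cyl) \<inter> susp M \<phi> = flow t -` E \<inter> space (susp_measure M \<phi>)"
    by (auto simp: space_susp_measure space_pair_measure susp_def)
  ultimately show "flow t -` E \<inter> space (susp_measure M \<phi>) \<in> null_sets (susp_measure M \<phi>)"
    by (simp add: null_sets_susp_measure space_susp_measure)
qed

text \<open>The constant is the same for all \<open>f\<close>, whether or not the roof is
  integrable, so it cancels from every duality relation.\<close>

lemma zext_susp_integral:
  obtains c where "0 < c"
    "\<And>f. integrable (susp_measure M \<phi>) (zext f) \<longleftrightarrow> integrable (mutil M) f"
    "\<And>f. f \<in> borel_measurable (mutil M) \<Longrightarrow>
      (\<integral>p. zext f p \<partial>susp_measure M \<phi>) = c *\<^sub>R (\<integral>p. f p \<partial>mutil M)"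
proof (rule susp_measure_density)
  fix c assume c: "0 < c" "susp_measure M \<phi> = density (restrict_space cyl (susp M \<phi>)) (\<lambda>_. ennreal c)"
  have eq: "indicator (susp M \<phi>) p *\<^sub>R zext f p = zext f p" for f p
    using Ytil_subset_susp by (auto simp: zext_def indicator_def)
  then have eq': "(indicator (susp M \<phi>) p * c) *\<^sub>R zext f p = c *\<^sub>R zext f p" for f p
    by (metis mult.commute scaleR_scaleR)
  show ?thesis
  proof (rule that[OF c(1)])
    fix f
    have iff: "zext f \<in> borel_measurable (restrict_space cyl (susp M \<phi>)) \<longleftrightarrow> zext f \<in> borel_measurable cyl"
      by (simp add: borel_measurable_restrict_space_iff[OF susp_Int_sets] eq)
    have scale: "integrable cyl (\<lambda>p. c *\<^sub>R zext f p) \<longleftrightarrow> integrable cyl (zext f)"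
      using c(1) integrable_scaleR_right[of "1 / c" cyl "\<lambda>p. c *\<^sub>R zext f p"] by auto
    show "integrable (susp_measure M \<phi>) (zext f) \<longleftrightarrow> integrable (mutil M) f"
    proof (cases "zext f \<in> borel_measurable cyl")
      case True
      then show ?thesis unfolding c(2) using c(1) iff
        by (subst integrable_density) (auto simp: scale integrable_restrict_space[OF susp_Int_sets] eq eq' integrable_mutil_iff)
    next
      case False
      then show ?thesis
        using iff borel_measurable_integrable[of "susp_measure M \<phi>" "zext f"]
        by (auto simp: integrable_mutil_iff measurable_cong_sets[OF sets_susp_measure refl])
    qed
    assume "f \<in> borel_measurable (mutil M)"
    then have "zext f \<in> borel_measurable cyl" by (rule zext_measurable)
    then show "(\<integral>p. zext f p \<partial>susp_measure M \<phi>) = c *\<^sub>R (\<integral>p. f p \<partial>mutil M)"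
      unfolding c(2) using c(1) iff
      by (subst integral_density) (auto simp: integral_restrict_space[OF susp_Int_sets] eq eq' integral_mutil)
  qed
qed

section \<open>Operators at a fixed time\<close>

lemma Top_eq_zext: "Top M F \<phi> t v = zext (Lop M F \<phi> t (zext v))"
  by (simp add: Top_def zext_def[abs_def])

lemma zext_zext: "zext (zext v) = zext v"
  by (auto simp: zext_def indicator_def)

lemma flow_test:
  assumes "unit_test (mutil M) w"
  shows "unit_test cyl (\<lambda>p. zext w (flow t p))" "unit_test (mutil M) (\<lambda>p. zext w (flow t p))"
proof -
  have W: "zext w \<in> borel_measurable cyl" "\<And>p. norm (zext w p) \<le> 1"
    using zext_unit_test[OF assms] by (auto simp: unit_test_def)
  show 1: "unit_test cyl (\<lambda>p. zext w (flow t p))"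
    using measurable_compose[OF flow_measurable_fixed W(1)] W(2) by (simp add: unit_test_def)
  then show "unit_test (mutil M) (\<lambda>p. zext w (flow t p))"
    by (auto simp: unit_test_def mutil_eq_restrict intro: measurable_restrict_space1)
qed

text \<open>The outer indicator in \<open>Top\<close> is absorbed by extending \<open>w\<close> by
  zero. Duality for \<open>Lop\<close> moves this extension along the flow, and the normalising
  constant appears once on each side.\<close>

lemma Top_spec:
  assumes t: "0 \<le> t" and v: "integrable (mutil M) v"
  shows "integrable (mutil M) (Top M F \<phi> t v)"
    and "unit_test (mutil M) w \<Longrightarrow>
      (\<integral>p. Top M F \<phi> t v p * w p \<partial>mutil M) = (\<integral>p. v p * zext w (flow t p) \<partial>mutil M)"
proof -
  let ?S = "susp_measure M \<phi>"
  obtain c where c: "0 < c"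
    "\<And>f. integrable ?S (zext f) \<longleftrightarrow> integrable (mutil M) f"
    "\<And>f. f \<in> borel_measurable (mutil M) \<Longrightarrow> (\<integral>p. zext f p \<partial>?S) = c *\<^sub>R (\<integral>p. f p \<partial>mutil M)"
    using zext_susp_integral by blast
  have v': "integrable ?S (zext v)" using v c(2) by simp
  note L = transfer_op_spec[OF sigma_finite_susp_measure flow_null_reflecting[OF t] v', folded Lop_def]
  have [measurable]: "Ytil M \<in> sets ?S"
    using Ytil_subset_susp Ytil_sets
    by (simp only: sets_susp_measure sets_restrict_space_iff[OF susp_Int_sets])
  have "integrable ?S (zext (Lop M F \<phi> t (zext v)))"
    using integrable_mult_indicator[OF _ L(1), of "Ytil M"] by (simp add: zext_eq_scaleR[abs_def])
  then show int: "integrable (mutil M) (Top M F \<phi> t v)"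
    using c(2)[of "Top M F \<phi> t v"] by (simp add: Top_eq_zext zext_zext)
  assume w: "unit_test (mutil M) w"
  have "unit_test ?S (zext w)"
    using zext_unit_test[OF w]
    by (auto simp: unit_test_def measurable_cong_sets[OF sets_susp_measure refl] intro: measurable_restrict_space1)
  then have W: "zext w \<in> Linf ?S" by (rule unit_test_Linf)
  have [measurable]: "w \<in> borel_measurable (mutil M)" "Top M F \<phi> t v \<in> borel_measurable (mutil M)"
    "v \<in> borel_measurable (mutil M)" "(\<lambda>p. zext w (flow t p)) \<in> borel_measurable (mutil M)"
    using w int v flow_test(2)[OF w, of t] by (auto simp: unit_test_def)
  have "c *\<^sub>R (\<integral>p. Top M F \<phi> t v p * w p \<partial>mutil M) = (\<integral>p. zext (\<lambda>p. Top M F \<phi> t v p * w p) p \<partial>?S)"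
    by (rule c(3)[symmetric]) measurable
  also have "\<dots> = (\<integral>p. Lop M F \<phi> t (zext v) p * zext w p \<partial>?S)"
    by (intro Bochner_Integration.integral_cong refl) (auto simp: Top_eq_zext zext_def indicator_def)
  also have "\<dots> = (\<integral>p. zext v p * zext w (flow t p) \<partial>?S)"
    by (rule L(2)[OF W])
  also have "\<dots> = (\<integral>p. zext (\<lambda>p. v p * zext w (flow t p)) p \<partial>?S)"
    by (intro Bochner_Integration.integral_cong refl) (auto simp: zext_def)
  also have "\<dots> = c *\<^sub>R (\<integral>p. v p * zext w (flow t p) \<partial>mutil M)"
    by (rule c(3)) measurable
  finally show "(\<integral>p. Top M F \<phi> t v p * w p \<partial>mutil M) = (\<integral>p. v p * zext w (flow t p) \<partial>mutil M)"
    using c(1) by simp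
qed

lemma Top_norm_le:
  assumes "0 \<le> t" "integrable (mutil M) v"
  shows "(\<integral>p. norm (Top M F \<phi> t v p) \<partial>mutil M) \<le> (\<integral>p. norm (v p) \<partial>mutil M)"
  using norm_integral_unit_test_le[OF assms(2) flow_test(2)]
  by (intro norm_integral_le_by_duality Top_spec(1) assms) (simp add: Top_spec(2)[OF assms])


lemma
  fixes f :: "'a \<times> real \<Rightarrow> 'c::{banach, second_countable_topology}"
  assumes f[measurable]: "f \<in> borel_measurable cyl"
  shows integral_cyl_translate: "(\<integral>p. f (fst p, snd p + h) \<partial>cyl) = (\<integral>p. f p \<partial>cyl)"
    and integrable_cyl_translate: "integrable cyl (\<lambda>p. f (fst p, snd p + h)) \<longleftrightarrow> integrable cyl f"
proof -
  have D: "distr cyl cyl (\<lambda>p. (fst p, snd p + h)) = cyl"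
    using distr_skew_translation[of "\<lambda>y. y" "\<lambda>_. h"] by (simp add: distr_id[unfolded id_def])
  have h: "(\<lambda>p. (fst p, snd p + h)) \<in> measurable cyl cyl" by measurable
  show "(\<integral>p. f (fst p, snd p + h) \<partial>cyl) = (\<integral>p. f p \<partial>cyl)"
    using integral_distr[OF h f] by (simp only: D)
  show "integrable cyl (\<lambda>p. f (fst p, snd p + h)) \<longleftrightarrow> integrable cyl f"
    using integrable_distr_eq[OF h f] by (simp only: D)
qed

text \<open>Translation in the second coordinate is continuous in L1 on almost every fibre; twice
  the fibre norm of \<open>zext v\<close> dominates, so the convergence integrates over the
  base.\<close>

lemma zext_translation_tendsto:
  assumes v: "integrable (mutil M) v" and h: "h \<longlonglongrightarrow> 0"
  shows "(\<lambda>i. \<integral>p. norm (zext v (fst p, snd p + h i) - zext v p) \<partial>cyl) \<longlonglongrightarrow> 0"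
proof -
  interpret pair_sigma_finite M "lborel :: real measure" by (rule pair_sigma_finite_cyl)
  have V: "integrable cyl (zext v)" using v by (simp add: integrable_mutil_iff)
  then have V_meas[measurable]: "zext v \<in> borel_measurable cyl" by simp
  have int: "integrable cyl (\<lambda>p. norm (zext v (fst p, snd p + h i) - zext v p))" for i
    using V integrable_cyl_translate[OF V_meas, of "h i"] by auto
  have "(\<lambda>i. \<integral>y. (\<integral>u. norm (zext v (y, u + h i) - zext v (y, u)) \<partial>lborel) \<partial>M) \<longlonglongrightarrow> (\<integral>y. 0 \<partial>M)"
  proof (rule integral_dominated_convergence[where w = "\<lambda>y. 2 * (\<integral>u. norm (zext v (y, u)) \<partial>lborel)"])
    show "AE y in M. (\<lambda>i. \<integral>u. norm (zext v (y, u + h i) - zext v (y, u)) \<partial>lborel) \<longlonglongrightarrow> 0"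
      using AE_integrable_fst'[OF V] by eventually_elim (rule L1_translation_continuous[OF _ h])
    show "integrable M (\<lambda>y. 2 * (\<integral>u. norm (zext v (y, u)) \<partial>lborel))"
      using integrable_fst'[OF integrable_norm[OF V]] by simp
    show "(\<lambda>y. \<integral>u. norm (zext v (y, u + h i) - zext v (y, u)) \<partial>lborel) \<in> borel_measurable M" for i
      using borel_measurable_integrable[OF integrable_fst'[OF int[of i]]] by simp
    show "AE y in M. norm (\<integral>u. norm (zext v (y, u + h i) - zext v (y, u)) \<partial>lborel)
        \<le> 2 * (\<integral>u. norm (zext v (y, u)) \<partial>lborel)" for i
      using AE_integrable_fst'[OF V]
    proof eventually_elim
      fix y assume y: "integrable lborel (\<lambda>u. zext v (y, u))"
      then have y': "integrable lborel (\<lambda>u. zext v (y, u + h i))"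
        using integrable_lborel_translate[of "\<lambda>u. zext v (y, u)" "h i"] by simp
      have "(\<integral>u. norm (zext v (y, u + h i) - zext v (y, u)) \<partial>lborel)
          \<le> (\<integral>u. norm (zext v (y, u + h i)) + norm (zext v (y, u)) \<partial>lborel)"
        using y y' by (intro integral_mono) (auto intro: norm_triangle_ineq4)
      also have "\<dots> = (\<integral>u. norm (zext v (y, u + h i)) \<partial>lborel) + (\<integral>u. norm (zext v (y, u)) \<partial>lborel)"
        using y y' by simp
      also have "(\<integral>u. norm (zext v (y, u + h i)) \<partial>lborel) = (\<integral>u. norm (zext v (y, u)) \<partial>lborel)"
        by (rule lborel_integral_translate[of "\<lambda>u. norm (zext v (y, u))"])
      finally show "norm (\<integral>u. norm (zext v (y, u + h i) - zext v (y, u)) \<partial>lborel)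
          \<le> 2 * (\<integral>u. norm (zext v (y, u)) \<partial>lborel)" by simp
    qed
  qed simp
  moreover have "(\<integral>y. (\<integral>u. norm (zext v (y, u + h i) - zext v (y, u)) \<partial>lborel) \<partial>M)
      = (\<integral>p. norm (zext v (fst p, snd p + h i) - zext v p) \<partial>cyl)" for i
    using integral_fst'[OF int[of i]] by simp
  ultimately show ?thesis by simp
qed

text \<open>For short times the flow only translates the second coordinate of points of \<open>Ytil\<close>, so by
  duality the modulus of continuity of \<open>Top\<close> is that of translations in \<open>L\<^sup>1\<close>.\<close>

lemma Top_diff_norm_le:
  assumes t: "0 \<le> t" and h: "0 \<le> h" "h \<le> 1" and a: "integrable (mutil M) a" and b: "integrable (mutil M) b"
  shows "(\<integral>p. norm (Top M F \<phi> (t + h) a p - Top M F \<phi> t b p) \<partial>mutil M)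
    \<le> (\<integral>p. norm (a p - b p) \<partial>mutil M) + (\<integral>p. norm (zext b (fst p, snd p + - h) - zext b p) \<partial>cyl)"
proof (rule norm_integral_le_by_duality)
  have th: "0 \<le> t + h" using t h by simp
  show "integrable (mutil M) (\<lambda>p. Top M F \<phi> (t + h) a p - Top M F \<phi> t b p)"
    using Top_spec(1)[OF th a] Top_spec(1)[OF t b] by simp
  fix w assume w: "unit_test (mutil M) w"
  let ?W = "\<lambda>t p. zext w (flow t p)"
  have W: "?W t \<in> Linf (mutil M)" "?W t \<in> Linf cyl" for t
    using flow_test[OF w] by (auto intro: unit_test_Linf)
  have B: "integrable cyl (zext b)" using b by (simp add: integrable_mutil_iff)
  have [measurable]: "zext b \<in> borel_measurable cyl" using B by auto
  have [measurable]: "?W t \<in> borel_measurable cyl" using flow_test(1)[OF w, of t] by (simp add: unit_test_def)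
  have B': "integrable cyl (\<lambda>p. zext b (fst p, snd p + - h))"
    using B by (subst integrable_cyl_translate) auto
  have ab: "norm (\<integral>p. (a p - b p) * ?W (t + h) p \<partial>mutil M) \<le> (\<integral>p. norm (a p - b p) \<partial>mutil M)"
    using a b flow_test(2)[OF w] by (intro norm_integral_unit_test_le) auto
  have "(\<integral>p. b p * ?W (t + h) p \<partial>mutil M) = (\<integral>p. zext b p * ?W t (fst p, snd p + h) \<partial>cyl)"
    unfolding integral_mutil
  proof (intro Bochner_Integration.integral_cong refl)
    fix p
    show "zext (\<lambda>p. b p * ?W (t + h) p) p = zext b p * ?W t (fst p, snd p + h)"
    proof (cases "p \<in> Ytil M")
      case True
      then obtain y u where p: "p = (y, u)" "y \<in> space M" "0 \<le> u" "u \<le> 1" by (auto simp: Ytil_def)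
      have "flow (t + h) p = flow t (flow h p)"
        using flow_add[of p h t] True Ytil_subset_susp t h by (auto simp: add.commute)
      also have "flow h p = (fst p, snd p + h)" using flow_short[of y u h] p h by simp
      finally show ?thesis by (simp add: zext_def)
    qed (simp add: zext_def)
  qed
  also have "\<dots> = (\<integral>p. (\<lambda>p. zext b (fst p, snd p + - h) * ?W t p) (fst p, snd p + h) \<partial>cyl)"
    by simp
  \<comment> \<open>Translation invariance moves the shift from the test function to
    \<open>b\<close>, so regularity of \<open>w\<close> does not enter the estimate.\<close>
  also have "\<dots> = (\<integral>p. zext b (fst p, snd p + - h) * ?W t p \<partial>cyl)"
    by (rule integral_cyl_translate) measurable
  finally have shift: "(\<integral>p. b p * ?W (t + h) p \<partial>mutil M) = (\<integral>p. zext b (fst p, snd p + - h) * ?W t p \<partial>cyl)" .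
  have "(\<integral>p. b p * ?W t p \<partial>mutil M) = (\<integral>p. zext b p * ?W t p \<partial>cyl)"
    unfolding integral_mutil by (intro Bochner_Integration.integral_cong refl) (simp add: zext_def)
  with shift have diff: "(\<integral>p. b p * ?W (t + h) p \<partial>mutil M) - (\<integral>p. b p * ?W t p \<partial>mutil M)
      = (\<integral>p. (zext b (fst p, snd p + - h) - zext b p) * ?W t p \<partial>cyl)"
    using integrable_mult_Linf[OF B W(2)[of t]] integrable_mult_Linf[OF B' W(2)[of t]]
    by (simp add: left_diff_distrib)
  have bb: "norm ((\<integral>p. b p * ?W (t + h) p \<partial>mutil M) - (\<integral>p. b p * ?W t p \<partial>mutil M))
      \<le> (\<integral>p. norm (zext b (fst p, snd p + - h) - zext b p) \<partial>cyl)"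
    unfolding diff using B B' flow_test(1)[OF w] by (intro norm_integral_unit_test_le) auto
  note wi = integrable_mult_Linf[OF _ unit_test_Linf[OF w]]
  have "(\<integral>p. (Top M F \<phi> (t + h) a p - Top M F \<phi> t b p) * w p \<partial>mutil M)
      = (\<integral>p. a p * ?W (t + h) p \<partial>mutil M) - (\<integral>p. b p * ?W t p \<partial>mutil M)"
    using wi[OF Top_spec(1)[OF th a]] wi[OF Top_spec(1)[OF t b]] Top_spec(2)[OF th a w] Top_spec(2)[OF t b w]
    by (simp add: left_diff_distrib)
  \<comment> \<open>The arguments \<open>a\<close> and \<open>b\<close> differ because the function
    inside \<open>Uop\<close> changes with time; the first term records this, the second the motion
    of the flow.\<close>
  also have "\<dots> = (\<integral>p. (a p - b p) * ?W (t + h) p \<partial>mutil M)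
      + ((\<integral>p. b p * ?W (t + h) p \<partial>mutil M) - (\<integral>p. b p * ?W t p \<partial>mutil M))"
    using integrable_mult_Linf[OF a W(1)[of "t + h"]] integrable_mult_Linf[OF b W(1)[of "t + h"]]
    by (simp add: left_diff_distrib)
  also have "norm \<dots> \<le> (\<integral>p. norm (a p - b p) \<partial>mutil M) + (\<integral>p. norm (zext b (fst p, snd p + - h) - zext b p) \<partial>cyl)"
    by (rule norm_triangle_le[OF add_mono[OF ab bb]])
  finally show "norm (\<integral>p. (Top M F \<phi> (t + h) a p - Top M F \<phi> t b p) * w p \<partial>mutil M)
    \<le> (\<integral>p. norm (a p - b p) \<partial>mutil M) + (\<integral>p. norm (zext b (fst p, snd p + - h) - zext b p) \<partial>cyl)" .
qed

section \<open>Laplace transforms on the product of times and points\<close>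

abbreviation times :: "real measure" where
  "times \<equiv> restrict_space lborel {0<..}"

lemma space_times: "space times = {0<..}"
  by (simp add: space_restrict_space)

lemma pair_sigma_finite_times_mutil: "pair_sigma_finite times (mutil M)"
  unfolding pair_sigma_finite_def
  by (intro conjI sigma_finite_measure_restrict_space lborel.sigma_finite_measure_axioms
      finite_measure.axioms(1)[OF finite_measure_mutil]) simp

lemma times_ident [measurable]: "(\<lambda>t. t) \<in> borel_measurable times"
  by (intro measurable_restrict_space1) simp

lemma mutil_ident [measurable]: "(\<lambda>p. p) \<in> measurable (mutil M) cyl"
  unfolding mutil_eq_restrict by (intro measurable_restrict_space1) simp

lemma times_fst [measurable]: "fst \<in> borel_measurable (times \<Otimes>\<^sub>M mutil M)"
  using measurable_compose[OF measurable_fst times_ident] .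

lemma flow_times_measurable [measurable]:
  "(\<lambda>q. flow (fst q) (snd q)) \<in> measurable (times \<Otimes>\<^sub>M mutil M) cyl"
proof -
  have "(\<lambda>q. (fst q, snd q)) \<in> measurable (times \<Otimes>\<^sub>M mutil M) (lborel \<Otimes>\<^sub>M cyl)"
    using times_fst measurable_compose[OF measurable_snd mutil_ident, of times]
    by (intro measurable_Pair) simp_all
  from measurable_compose[OF this flow_measurable] show ?thesis by simp
qed

text \<open>Every time slice of the preimage is null by the statement for a fixed time. This lets
  \<open>pushforward_density\<close> produce the value of a Laplace integral.\<close>

lemma flow_times_null_reflecting:
  "null_reflecting (times \<Otimes>\<^sub>M mutil M) cyl (\<lambda>q. flow (fst q) (snd q))"
  unfolding null_reflecting_def
proof (intro conjI ballI flow_times_measurable)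
  interpret pair_sigma_finite times "mutil M" by (rule pair_sigma_finite_times_mutil)
  fix E assume E: "E \<in> null_sets cyl"
  let ?A = "(\<lambda>q. flow (fst q) (snd q)) -` E \<inter> space (times \<Otimes>\<^sub>M mutil M)"
  have A: "?A \<in> sets (times \<Otimes>\<^sub>M mutil M)"
    using E by (intro measurable_sets[OF flow_times_measurable]) auto
  have "emeasure (mutil M) (Pair t -` ?A) = 0" for t
  proof -
    have "flow t -` E \<inter> space cyl \<in> null_sets cyl"
      using flow_null_reflecting_product[of t] E by (simp add: null_reflecting_def)
    then have "(flow t -` E \<inter> space cyl) \<inter> Ytil M \<in> null_sets cyl"
      by (rule null_set_Int2[OF _ Ytil_sets])
    then have N: "(flow t -` E \<inter> space cyl) \<inter> Ytil M \<in> null_sets (mutil M)"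
      unfolding mutil_eq_restrict by (simp only: null_sets_restrict_space[OF Ytil_sets]) blast
    have "Pair t -` ?A \<subseteq> (flow t -` E \<inter> space cyl) \<inter> Ytil M"
      by (auto simp: space_pair_measure space_mutil Ytil_def)
    then have "Pair t -` ?A \<in> null_sets (mutil M)"
      by (rule null_sets_subset[OF N sets_Pair1[OF A]])
    then show ?thesis by auto
  qed
  then have "emeasure (times \<Otimes>\<^sub>M mutil M) ?A = 0"
    by (simp add: M2.emeasure_pair_measure_alt[OF A])
  with A show "?A \<in> null_sets (times \<Otimes>\<^sub>M mutil M)" by auto
qed

lemma integrable_laplace_kernel:
  assumes v: "integrable (mutil M) v" and s: "Re s > 0"
    and [measurable]: "f \<in> borel_measurable (times \<Otimes>\<^sub>M mutil M)"
    and bound: "\<And>t p. t \<in> {0<..} \<Longrightarrow> p \<in> Ytil M \<Longrightarrow> norm (f (t, p) :: complex) \<le> norm (v p :: complex)"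
  shows "integrable (times \<Otimes>\<^sub>M mutil M) (\<lambda>q. exp (- s * of_real (fst q)) * f q)"
proof -
  interpret pair_sigma_finite times "mutil M" by (rule pair_sigma_finite_times_mutil)
  have [measurable]: "v \<in> borel_measurable (mutil M)" using v by auto
  have E: "integrable times (\<lambda>t. exp (- Re s * t))"
    using integrable_I0i_exp_mscale[OF s]
    by (simp add: integrable_restrict_space set_integrable_def mult.commute)
  have "integrable (times \<Otimes>\<^sub>M mutil M) (\<lambda>q. exp (- Re s * fst q) * norm (v (snd q)))"
  proof (rule Fubini_integrable)
    show "integrable times (\<lambda>t. \<integral>p. norm (exp (- Re s * fst (t, p)) * norm (v (snd (t, p)))) \<partial>mutil M)"
      using E by (simp add: abs_mult)
    show "AE t in times. integrable (mutil M) (\<lambda>p. exp (- Re s * fst (t, p)) * norm (v (snd (t, p))))"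
      using v by simp
  qed measurable
  then show ?thesis
  proof (rule Bochner_Integration.integrable_bound)
    show "AE q in times \<Otimes>\<^sub>M mutil M.
        norm (exp (- s * of_real (fst q)) * f q) \<le> norm (exp (- Re s * fst q) * norm (v (snd q)))"
      using bound by (intro AE_I2) (auto simp: space_pair_measure space_times space_mutil norm_mult abs_mult
          simp flip: exp_minus intro!: mult_left_mono)
  qed measurable
qed

text \<open>The family \<open>k\<close> covers both transforms: it is constant in \<open>t\<close>
  for \<open>That\<close>, and cut off to \<open>t < \<phi>(p)\<close> for \<open>Uhat\<close>. The
  bound by \<open>v\<close> and right continuity in \<open>t\<close> are what the two families
  share.\<close>

lemma laplace_Top_unit_test:
  fixes k :: "real \<Rightarrow> 'a \<times> real \<Rightarrow> complex" and v :: "'a \<times> real \<Rightarrow> complex"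
  assumes v: "integrable (mutil M) v" and s: "Re s > 0"
    and k_meas: "(\<lambda>q. k (fst q) (snd q)) \<in> borel_measurable (times \<Otimes>\<^sub>M mutil M)"
    and k_bound: "\<And>t p. norm (k t p) \<le> norm (v p)"
    and k_cont: "\<And>t \<tau> p. (\<And>i. t < \<tau> i) \<Longrightarrow> \<tau> \<longlonglongrightarrow> t \<Longrightarrow> (\<lambda>i. k (\<tau> i) p) \<longlonglongrightarrow> k t p"
  defines "I \<equiv> L1_integral times (mutil M) (\<lambda>t p. exp (- s * of_real t) * Top M F \<phi> t (k t) p)"
  shows "integrable (mutil M) I"
    and "unit_test (mutil M) w \<Longrightarrow> (\<integral>p. I p * w p \<partial>mutil M) =
      (\<integral>q. exp (- s * of_real (fst q)) * (k (fst q) (snd q) * zext w (flow (fst q) (snd q))) \<partial>(times \<Otimes>\<^sub>M mutil M))"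
proof -
  interpret TM: pair_sigma_finite times "mutil M" by (rule pair_sigma_finite_times_mutil)
  note k_meas[measurable]
  let ?G = "\<lambda>t p. exp (- s * complex_of_real t) * Top M F \<phi> t (k t) p"
  let ?X = "\<lambda>w q. exp (- s * of_real (fst q)) * (k (fst q) (snd q) * zext w (flow (fst q) (snd q)))"
  have kt: "integrable (mutil M) (k t)" if "0 < t" for t
  proof (rule Bochner_Integration.integrable_bound[OF v])
    have "(\<lambda>p. (\<lambda>q. k (fst q) (snd q)) (t, p)) \<in> borel_measurable (mutil M)"
      using that by (intro measurable_compose[OF measurable_Pair1' k_meas]) (simp add: space_times)
    then show "k t \<in> borel_measurable (mutil M)" by simp
  qed (use k_bound in auto)
  have X: "integrable (times \<Otimes>\<^sub>M mutil M) (?X w)" if w: "unit_test (mutil M) w" for w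
  proof (rule integrable_laplace_kernel[OF v s])
    have "zext w \<in> borel_measurable cyl" using zext_unit_test[OF w] by (simp add: unit_test_def)
    from measurable_compose[OF flow_times_measurable this]
    show "(\<lambda>q. k (fst q) (snd q) * zext w (flow (fst q) (snd q))) \<in> borel_measurable (times \<Otimes>\<^sub>M mutil M)"
      by measurable
    fix t p
    have "norm (zext w (flow t p)) \<le> 1" using zext_unit_test[OF w] unfolding unit_test_def by blast
    with k_bound[of t p] have "norm (k t p) * norm (zext w (flow t p)) \<le> norm (v p) * 1"
      by (intro mult_mono) auto
    then show "norm (k (fst (t, p)) (snd (t, p)) * zext w (flow (fst (t, p)) (snd (t, p)))) \<le> norm (v p)"
      by (simp add: norm_mult)
  qed
  \<comment> \<open>Here the separately selected functions \<open>Top M F \<phi> t (k t)\<close> are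
    traded for the jointly measurable integrand \<open>?X w\<close>.\<close>
  have GX: "(\<integral>p. ?G t p * w p \<partial>mutil M) = (\<integral>p. ?X w (t, p) \<partial>mutil M)"
    if w: "unit_test (mutil M) w" and t: "t \<in> space times" for w t
  proof -
    have t: "0 < t" using t by (simp add: space_times)
    have "(\<integral>p. ?G t p * w p \<partial>mutil M) = exp (- s * of_real t) * (\<integral>p. Top M F \<phi> t (k t) p * w p \<partial>mutil M)"
      by (simp add: mult.assoc)
    also have "\<dots> = exp (- s * of_real t) * (\<integral>p. k t p * zext w (flow t p) \<partial>mutil M)"
      using t by (simp add: Top_spec(2)[OF _ kt w])
    finally show ?thesis by simp
  qed
  have Gw: "integrable times (\<lambda>t. \<integral>p. ?G t p * w p \<partial>mutil M)" if w: "unit_test (mutil M) w" for w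
    using TM.integrable_fst'[OF X[OF w]]
    by (subst Bochner_Integration.integrable_cong[OF refl GX[OF w]]) auto
  have GwX: "(\<integral>t. (\<integral>p. ?G t p * w p \<partial>mutil M) \<partial>times) = (\<integral>q. ?X w q \<partial>(times \<Otimes>\<^sub>M mutil M))"
    if w: "unit_test (mutil M) w" for w
    using TM.integral_fst'[OF X[OF w]]
    by (subst Bochner_Integration.integral_cong[OF refl GX[OF w]]) auto
  have "has_L1_integral times (mutil M) ?G I"
  proof -
    \<comment> \<open>The candidate \<open>J\<close> is the image under the flow of the weighted
      function on times and points; restricted to \<open>Ytil\<close> it has the required
      pairings.\<close>
    have "integrable (times \<Otimes>\<^sub>M mutil M) (\<lambda>q. exp (- s * of_real (fst q)) * k (fst q) (snd q))"
      using k_bound by (intro integrable_laplace_kernel[OF v s]) auto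
    from pushforward_density[OF sigma_finite_cyl flow_times_null_reflecting this]
    obtain J where J: "integrable cyl J"
      "\<And>w. w \<in> Linf cyl \<Longrightarrow> (\<integral>p. J p * w p \<partial>cyl)
        = (\<integral>q. exp (- s * of_real (fst q)) * k (fst q) (snd q) * w (flow (fst q) (snd q)) \<partial>(times \<Otimes>\<^sub>M mutil M))"
      by auto
    have intJ: "integrable (mutil M) J"
      using integrable_mult_indicator[OF Ytil_sets J(1)]
      by (simp add: integrable_mutil_iff zext_eq_scaleR[abs_def])
    have Jw: "(\<integral>p. J p * w p \<partial>mutil M) = (\<integral>t. (\<integral>p. ?G t p * w p \<partial>mutil M) \<partial>times)"
      if w: "unit_test (mutil M) w" for w
    proof -
      have "(\<integral>p. J p * w p \<partial>mutil M) = (\<integral>p. J p * zext w p \<partial>cyl)"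
        unfolding integral_mutil by (intro Bochner_Integration.integral_cong refl) (simp add: zext_def)
      also have "\<dots> = (\<integral>q. ?X w q \<partial>(times \<Otimes>\<^sub>M mutil M))"
        using J(2)[OF unit_test_Linf[OF zext_unit_test[OF w]]] by (simp add: mult.assoc)
      finally show ?thesis by (simp only: GwX[OF w])
    qed
    have "has_L1_integral times (mutil M) ?G J"
    proof (rule has_L1_integral_laplace[where C = "\<integral>p. norm (v p) \<partial>mutil M", OF _ _ _ s intJ])
      fix t :: real assume t: "0 < t"
      show "integrable (mutil M) (Top M F \<phi> t (k t))" using t by (intro Top_spec(1) kt) auto
      have "(\<integral>p. norm (Top M F \<phi> t (k t) p) \<partial>mutil M) \<le> (\<integral>p. norm (k t p) \<partial>mutil M)"
        using t by (intro Top_norm_le kt) auto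
      also have "\<dots> \<le> (\<integral>p. norm (v p) \<partial>mutil M)"
        using v kt[OF t] k_bound by (intro integral_mono) auto
      finally show "(\<integral>p. norm (Top M F \<phi> t (k t) p) \<partial>mutil M) \<le> (\<integral>p. norm (v p) \<partial>mutil M)" .
      fix \<tau> assume \<tau>: "\<And>i::nat. t < \<tau> i" "\<tau> \<longlonglongrightarrow> t"
      have \<tau>0: "0 < \<tau> i" for i using t \<tau>(1)[of i] by linarith
      \<comment> \<open>The first term is controlled by pointwise right continuity of
        \<open>k\<close>, the second by continuity of translations in L1.\<close>
      let ?b = "\<lambda>i. (\<integral>p. norm (k (\<tau> i) p - k t p) \<partial>mutil M)
          + (\<integral>p. norm (zext (k t) (fst p, snd p + - (\<tau> i - t)) - zext (k t) p) \<partial>cyl)"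
      have "(\<lambda>i. - (\<tau> i - t)) \<longlonglongrightarrow> - (t - t)"
        by (intro tendsto_intros \<tau>(2))
      then have "(\<lambda>i. \<integral>p. norm (zext (k t) (fst p, snd p + - (\<tau> i - t)) - zext (k t) p) \<partial>cyl) \<longlonglongrightarrow> 0"
        by (intro zext_translation_tendsto kt[OF t]) simp
      moreover have "(\<lambda>i. \<integral>p. norm (k (\<tau> i) p - k t p) \<partial>mutil M) \<longlonglongrightarrow> (\<integral>p. 0 \<partial>mutil M)"
      proof (rule integral_dominated_convergence[where w = "\<lambda>p. 2 * norm (v p)"])
        show "AE p in mutil M. (\<lambda>i. norm (k (\<tau> i) p - k t p)) \<longlonglongrightarrow> 0"
          using k_cont[OF \<tau>] by (intro AE_I2 tendsto_norm_zero LIM_zero)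
        show "AE p in mutil M. norm (norm (k (\<tau> i) p - k t p)) \<le> 2 * norm (v p)" for i
        proof (rule AE_I2)
          fix p
          show "norm (norm (k (\<tau> i) p - k t p)) \<le> 2 * norm (v p)"
            using norm_triangle_ineq4[of "k (\<tau> i) p" "k t p"] k_bound[of "\<tau> i" p] k_bound[of t p] by simp
        qed
      qed (use v kt[OF t] kt[OF \<tau>0] in auto)
      ultimately have b: "?b \<longlonglongrightarrow> 0"
        by (intro tendsto_add_zero) simp_all
      show "(\<lambda>i. \<integral>p. norm (Top M F \<phi> (\<tau> i) (k (\<tau> i)) p - Top M F \<phi> t (k t) p) \<partial>mutil M) \<longlonglongrightarrow> 0"
      proof (rule tendsto_sandwich[OF _ _ tendsto_const b])
        \<comment> \<open>Increments of at most 1 are those for which the flow merely translates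
          \<open>Ytil\<close>.\<close>
        have "\<forall>\<^sub>F i in sequentially. \<tau> i < t + 1" using \<tau>(2) by (rule order_tendstoD) simp
        then show "\<forall>\<^sub>F i in sequentially.
            (\<integral>p. norm (Top M F \<phi> (\<tau> i) (k (\<tau> i)) p - Top M F \<phi> t (k t) p) \<partial>mutil M) \<le> ?b i"
        proof eventually_elim
          fix i assume "\<tau> i < t + 1"
          then show "(\<integral>p. norm (Top M F \<phi> (\<tau> i) (k (\<tau> i)) p - Top M F \<phi> t (k t) p) \<partial>mutil M) \<le> ?b i"
            using Top_diff_norm_le[of t "\<tau> i - t" "k (\<tau> i)" "k t"] t \<tau>(1)[of i] kt[OF t] kt[OF \<tau>0[of i]] by simp
        qed
      qed simp
    next
      fix w assume w: "unit_test (mutil M) w"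
      show "integrable times (\<lambda>t. \<integral>p. ?G t p * w p \<partial>mutil M)" by (rule Gw[OF w])
      show "(\<integral>p. J p * w p \<partial>mutil M) = (\<integral>t. (\<integral>p. ?G t p * w p \<partial>mutil M) \<partial>times)" by (rule Jw[OF w])
    qed
    then show ?thesis unfolding I_def L1_integral_def
      by (rule someI[where P = "has_L1_integral times (mutil M) ?G"])
  qed
  note I = this
  show "integrable (mutil M) I" using I by (simp add: has_L1_integral_def)
  assume w: "unit_test (mutil M) w"
  show "(\<integral>p. I p * w p \<partial>mutil M) = (\<integral>q. ?X w q \<partial>(times \<Otimes>\<^sub>M mutil M))"
    using has_L1_integral_unit_test[OF I w Gw[OF w]] by (simp only: GwX[OF w])
qed


section \<open>The renewal equation\<close>

lemma Ftil_null_reflecting: "null_reflecting (mutil M) (mutil M) (Ftil F)"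
  unfolding null_reflecting_def
proof (intro conjI ballI)
  have eq: "Ftil F = (\<lambda>p. (F (fst p), snd p))" by (auto simp: Ftil_def)
  have "Ftil F \<in> measurable cyl cyl" unfolding eq by measurable
  then show "Ftil F \<in> measurable (mutil M) (mutil M)"
    unfolding mutil_eq_restrict
    by (intro measurable_restrict_space2 measurable_restrict_space1)
      (auto simp: space_restrict_space Ytil_def Ftil_def F_space)
  fix E assume "E \<in> null_sets (mutil M)"
  then have "E \<in> null_sets cyl" unfolding mutil_eq_restrict by (simp only: null_sets_restrict_space[OF Ytil_sets])
  from skew_translation_null_set[OF this F_measurable distr_F, of "\<lambda>_. 0"]
  have "Ftil F -` E \<inter> space cyl \<in> null_sets cyl" by (simp add: eq)
  then have "(Ftil F -` E \<inter> space cyl) \<inter> Ytil M \<in> null_sets cyl"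
    by (rule null_set_Int2[OF _ Ytil_sets])
  then have "(Ftil F -` E \<inter> space cyl) \<inter> Ytil M \<in> null_sets (mutil M)"
    unfolding mutil_eq_restrict by (simp only: null_sets_restrict_space[OF Ytil_sets]) blast
  moreover have "(Ftil F -` E \<inter> space cyl) \<inter> Ytil M = Ftil F -` E \<inter> space (mutil M)"
    by (auto simp: space_mutil space_pair_measure Ytil_def)
  ultimately show "Ftil F -` E \<inter> space (mutil M) \<in> null_sets (mutil M)" by simp
qed

lemma phitil_measurable [measurable]: "phitil \<phi> \<in> borel_measurable (mutil M)"
proof -
  have "phitil \<phi> = (\<lambda>p. \<phi> (fst p))" by (auto simp: phitil_def)
  moreover have "(\<lambda>p. \<phi> (fst p)) \<in> borel_measurable cyl" by measurable
  ultimately show ?thesis unfolding mutil_eq_restrict by (simp add: measurable_restrict_space1)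
qed

lemma phitil_gt: "p \<in> Ytil M \<Longrightarrow> 2 < phitil \<phi> p"
  using roof_gt_2 by (auto simp: phitil_def Ytil_def)

lemma norm_exp_phitil_le:
  assumes "Re s > 0" "p \<in> Ytil M"
  shows "norm (exp (- s * of_real (phitil \<phi> p)) * v p) \<le> norm (v p :: complex)"
  using phitil_gt[OF assms(2)] assms(1)
  by (simp add: norm_mult mult_left_le_one_le del: mult_minus_left)

lemma integrable_exp_phitil:
  assumes v: "integrable (mutil M) v" and s: "Re s > 0"
  shows "integrable (mutil M) (\<lambda>p. exp (- s * of_real (phitil \<phi> p)) * v p)"
proof (rule Bochner_Integration.integrable_bound[OF v])
  have [measurable]: "v \<in> borel_measurable (mutil M)" using v by auto
  show "(\<lambda>p. exp (- s * of_real (phitil \<phi> p)) * v p) \<in> borel_measurable (mutil M)" by measurable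
qed (use norm_exp_phitil_le[OF s] in \<open>auto simp: space_mutil intro!: AE_I2\<close>)

lemma Rhat_spec:
  assumes v: "integrable (mutil M) v" and s: "Re s > 0"
  shows "integrable (mutil M) (Rhat M F \<phi> s v)"
    and "u \<in> Linf (mutil M) \<Longrightarrow> (\<integral>p. Rhat M F \<phi> s v p * u p \<partial>mutil M)
      = (\<integral>p. exp (- s * of_real (phitil \<phi> p)) * v p * u (Ftil F p) \<partial>mutil M)"
  using transfer_op_spec[OF finite_measure.axioms(1)[OF finite_measure_mutil] Ftil_null_reflecting
      integrable_exp_phitil[OF v s]]
  by (auto simp: Rhat_def Rtil_def)

text \<open>The cut-off moves into the argument, turning \<open>Uop\<close> into \<open>Top\<close>
  applied to a function that depends on time.\<close>

lemma Uop_eq_Top: "Uop M F \<phi> t v = Top M F \<phi> t (\<lambda>p. if t < phitil \<phi> p then v p else 0)"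
proof -
  have "indicator {q \<in> Ytil M. phitil \<phi> q > t} q * v q
      = indicator (Ytil M) q * (if t < phitil \<phi> q then v q else 0)" for q
    by (auto simp: indicator_def)
  then show ?thesis unfolding Uop_def Top_def by simp
qed

lemma That_unit_test:
  assumes v: "integrable (mutil M) v" and s: "Re s > 0"
  shows "integrable (mutil M) (That M F \<phi> s v)"
    and "unit_test (mutil M) w \<Longrightarrow> (\<integral>p. That M F \<phi> s v p * w p \<partial>mutil M) =
      (\<integral>q. exp (- s * of_real (fst q)) * (v (snd q) * zext w (flow (fst q) (snd q))) \<partial>(times \<Otimes>\<^sub>M mutil M))"
proof -
  have [measurable]: "v \<in> borel_measurable (mutil M)" using v by auto
  have "(\<lambda>q. v (snd q)) \<in> borel_measurable (times \<Otimes>\<^sub>M mutil M)" by measurable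
  note * = laplace_Top_unit_test[where k = "\<lambda>_. v", OF v s this order_refl tendsto_const, folded That_def]
  show "integrable (mutil M) (That M F \<phi> s v)" by (rule *(1))
  show "unit_test (mutil M) w \<Longrightarrow> (\<integral>p. That M F \<phi> s v p * w p \<partial>mutil M) =
      (\<integral>q. exp (- s * of_real (fst q)) * (v (snd q) * zext w (flow (fst q) (snd q))) \<partial>(times \<Otimes>\<^sub>M mutil M))"
    by (rule *(2))
qed

lemma Uhat_unit_test:
  assumes v: "integrable (mutil M) v" and s: "Re s > 0"
  shows "integrable (mutil M) (Uhat M F \<phi> s v)"
    and "unit_test (mutil M) w \<Longrightarrow> (\<integral>p. Uhat M F \<phi> s v p * w p \<partial>mutil M) =
      (\<integral>q. exp (- s * of_real (fst q)) * ((if fst q < phitil \<phi> (snd q) then v (snd q) else 0)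
        * zext w (flow (fst q) (snd q))) \<partial>(times \<Otimes>\<^sub>M mutil M))"
proof -
  let ?k = "\<lambda>t p. if t < phitil \<phi> p then v p else 0"
  have [measurable]: "v \<in> borel_measurable (mutil M)" using v by auto
  have meas: "(\<lambda>q. ?k (fst q) (snd q)) \<in> borel_measurable (times \<Otimes>\<^sub>M mutil M)" by measurable
  have bound: "norm (?k t p) \<le> norm (v p)" for t p by simp
  \<comment> \<open>If \<open>t < \<phi>(p)\<close>, nearby later times still satisfy this; if not,
    no later time does. At \<open>t = \<phi>(p)\<close> only the approach from the right
    works.\<close>
  have cont: "(\<lambda>i. ?k (\<tau> i) p) \<longlonglongrightarrow> ?k t p" if \<tau>: "\<And>i. t < \<tau> i" "\<tau> \<longlonglongrightarrow> t" for t \<tau> p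
  proof (rule tendsto_eventually, cases "t < phitil \<phi> p")
    case True
    with \<tau>(2) have "\<forall>\<^sub>F i in sequentially. \<tau> i < phitil \<phi> p" by (rule order_tendstoD)
    then show "\<forall>\<^sub>F i in sequentially. ?k (\<tau> i) p = ?k t p" by eventually_elim (use True in simp)
  next
    case False
    then have "\<not> \<tau> i < phitil \<phi> p" for i using \<tau>(1)[of i] by linarith
    then show "\<forall>\<^sub>F i in sequentially. ?k (\<tau> i) p = ?k t p" using False by simp
  qed
  note * = laplace_Top_unit_test[where k = ?k, OF v s meas bound cont]
  show "integrable (mutil M) (Uhat M F \<phi> s v)" unfolding Uhat_def Uop_eq_Top by (rule *(1))
  show "unit_test (mutil M) w \<Longrightarrow> (\<integral>p. Uhat M F \<phi> s v p * w p \<partial>mutil M) =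
      (\<integral>q. exp (- s * of_real (fst q)) * ((if fst q < phitil \<phi> (snd q) then v (snd q) else 0)
        * zext w (flow (fst q) (snd q))) \<partial>(times \<Otimes>\<^sub>M mutil M))"
    unfolding Uhat_def Uop_eq_Top by (rule *(2))
qed

text \<open>At fixed \<open>p\<close> this is the substitution
  \<open>t \<mapsto> t + \<phi>(p)\<close>: the two exponential factors combine, and
  \<open>flow_renewal\<close> removes \<open>Ftil\<close>.\<close>

lemma renewal_time_integral:
  assumes w: "unit_test (mutil M) w" and p: "p \<in> Ytil M"
  shows "(\<integral>t. exp (- s * of_real t) * (exp (- s * of_real (phitil \<phi> p)) * v p * zext w (flow t (Ftil F p))) \<partial>times)
    = (\<integral>t. exp (- s * of_real t) * ((if t < phitil \<phi> p then 0 else v p) * zext w (flow t p)) \<partial>times)"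
proof -
  obtain y u where yu: "p = (y, u)" "y \<in> space M" "0 \<le> u" using p by (auto simp: Ytil_def)
  let ?\<phi> = "phitil \<phi> p"
  have \<phi>: "2 < ?\<phi>" using phitil_gt[OF p] .
  define f where "f t = indicator {?\<phi><..} t *\<^sub>R (exp (- s * complex_of_real t) * (v p * zext w (flow t p)))" for t
  have "zext w \<in> borel_measurable cyl" using zext_unit_test[OF w] by (simp add: unit_test_def)
  moreover have "(\<lambda>t. flow t p) \<in> measurable lborel cyl"
    using measurable_compose[OF measurable_Pair2' flow_measurable, of p] yu by (simp add: space_pair_measure)
  ultimately have [measurable]: "(\<lambda>t. zext w (flow t p)) \<in> borel_measurable lborel"
    by (rule measurable_compose[rotated])
  have "(\<integral>t. exp (- s * of_real t) * (exp (- s * of_real ?\<phi>) * v p * zext w (flow t (Ftil F p))) \<partial>times)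
      = (\<integral>t. f (t + ?\<phi>) \<partial>lborel)"
  proof (subst integral_restrict_space, simp, intro Bochner_Integration.integral_cong refl)
    fix t :: real
    show "indicator {0<..} t *\<^sub>R (exp (- s * of_real t) * (exp (- s * of_real ?\<phi>) * v p * zext w (flow t (Ftil F p))))
        = f (t + ?\<phi>)"
    proof (cases "0 < t")
      case True
      have "flow t (Ftil F p) = flow (t + ?\<phi>) p"
        using flow_renewal[OF yu(2,3), of t] True by (simp add: yu Ftil_def phitil_def)
      moreover have "exp (- s * of_real (t + ?\<phi>)) = exp (- s * of_real t) * exp (- s * of_real ?\<phi>)"
        by (simp add: distrib_left flip: exp_add)
      ultimately show ?thesis using True by (simp add: f_def mult.assoc)
    qed (simp add: f_def)
  qed
  also have "\<dots> = (\<integral>t. f t \<partial>lborel)" by (rule lborel_integral_translate)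
  \<comment> \<open>The shift of \<open>t > 0\<close> gives \<open>t > \<phi>(p)\<close>, whereas
    the complement of the cut-off in \<open>Uop\<close> is \<open>t \<ge> \<phi>(p)\<close>. The two
    integrands differ at most at one time.\<close>
  also have "\<dots> = (\<integral>t. indicator {0<..} t *\<^sub>R
      (exp (- s * of_real t) * ((if t < ?\<phi> then 0 else v p) * zext w (flow t p))) \<partial>lborel)"
  proof (rule integral_cong_AE)
    show "AE t in lborel. f t = indicator {0<..} t *\<^sub>R
      (exp (- s * of_real t) * ((if t < ?\<phi> then 0 else v p) * zext w (flow t p)))"
      using AE_lborel_singleton[of ?\<phi>] by eventually_elim (use \<phi> in \<open>auto simp: f_def indicator_def\<close>)
  qed (simp_all add: f_def[abs_def])
  also have "\<dots> = (\<integral>t. exp (- s * of_real t) * ((if t < ?\<phi> then 0 else v p) * zext w (flow t p)) \<partial>times)"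
    by (subst integral_restrict_space) auto
  finally show ?thesis .
qed

theorem renewal_equation:
  assumes v: "integrable (mutil M) v" and s: "Re s > 0"
  shows "AE p in mutil M. That M F \<phi> s (Rhat M F \<phi> s v) p = That M F \<phi> s v p - Uhat M F \<phi> s v p"
proof (rule AE_eq_by_duality)
  interpret TM: pair_sigma_finite times "mutil M" by (rule pair_sigma_finite_times_mutil)
  note R = Rhat_spec[OF v s] and T = That_unit_test[OF v s] and U = Uhat_unit_test[OF v s]
  note TR = That_unit_test[OF R(1) s]
  show "integrable (mutil M) (That M F \<phi> s (Rhat M F \<phi> s v))" by (rule TR(1))
  show "integrable (mutil M) (\<lambda>p. That M F \<phi> s v p - Uhat M F \<phi> s v p)" using T(1) U(1) by simp
  fix w assume w: "unit_test (mutil M) w"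
  have [measurable]: "v \<in> borel_measurable (mutil M)" "Rhat M F \<phi> s v \<in> borel_measurable (mutil M)"
    using v R(1) by auto
  have W: "zext w \<in> borel_measurable cyl" "\<And>p. norm (zext w p) \<le> 1"
    using zext_unit_test[OF w] by (auto simp: unit_test_def)
  have [measurable]: "(\<lambda>q. zext w (flow (fst q) (snd q))) \<in> borel_measurable (times \<Otimes>\<^sub>M mutil M)"
    by (rule measurable_compose[OF flow_times_measurable W(1)])
  have Ftil_meas: "Ftil F \<in> measurable (mutil M) (mutil M)"
    using Ftil_null_reflecting by (simp add: null_reflecting_def)
  have [measurable]: "(\<lambda>q. zext w (flow (fst q) (Ftil F (snd q)))) \<in> borel_measurable (times \<Otimes>\<^sub>M mutil M)"
  proof -
    have "(\<lambda>q. (fst q, Ftil F (snd q))) \<in> measurable (times \<Otimes>\<^sub>M mutil M) (times \<Otimes>\<^sub>M mutil M)"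
      using measurable_compose[OF measurable_snd Ftil_meas, of times] by (intro measurable_Pair measurable_fst)
    from measurable_compose[OF this measurable_compose[OF flow_times_measurable W(1)]] show ?thesis by simp
  qed
  have mult_W: "norm (a * zext w p) \<le> norm a" for a p
    using W(2)[of p] by (simp add: norm_mult mult_left_le)
  let ?e = "\<lambda>t. exp (- s * complex_of_real t)"
  let ?Rv = "\<lambda>q. ?e (fst q) * (Rhat M F \<phi> s v (snd q) * zext w (flow (fst q) (snd q)))"
  let ?Y = "\<lambda>q. ?e (fst q) * (?e (phitil \<phi> (snd q)) * v (snd q) * zext w (flow (fst q) (Ftil F (snd q))))"
  let ?Z = "\<lambda>q. ?e (fst q) * ((if fst q < phitil \<phi> (snd q) then 0 else v (snd q)) * zext w (flow (fst q) (snd q)))"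
  let ?V = "\<lambda>q. ?e (fst q) * (v (snd q) * zext w (flow (fst q) (snd q)))"
  let ?V' = "\<lambda>q. ?e (fst q) * ((if fst q < phitil \<phi> (snd q) then v (snd q) else 0) * zext w (flow (fst q) (snd q)))"
  have int_Rv: "integrable (times \<Otimes>\<^sub>M mutil M) ?Rv"
    by (rule integrable_laplace_kernel[OF R(1) s]) (measurable, use mult_W in auto)
  have int_Y: "integrable (times \<Otimes>\<^sub>M mutil M) ?Y"
    by (rule integrable_laplace_kernel[OF v s])
      (measurable, use order_trans[OF mult_W norm_exp_phitil_le[OF s]] in simp)
  have int_Z: "integrable (times \<Otimes>\<^sub>M mutil M) ?Z"
    by (rule integrable_laplace_kernel[OF v s]) (measurable, use mult_W in auto)
  have int_V: "integrable (times \<Otimes>\<^sub>M mutil M) ?V"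
    by (rule integrable_laplace_kernel[OF v s]) (measurable, use mult_W in auto)
  have int_V': "integrable (times \<Otimes>\<^sub>M mutil M) ?V'"
    by (rule integrable_laplace_kernel[OF v s]) (measurable, use mult_W in auto)
  have "(\<integral>p. That M F \<phi> s (Rhat M F \<phi> s v) p * w p \<partial>mutil M) = (\<integral>t. (\<integral>p. ?Rv (t, p) \<partial>mutil M) \<partial>times)"
    using TR(2)[OF w] TM.integral_fst'[OF int_Rv] by simp
  \<comment> \<open>For each fixed \<open>t\<close>, \<open>zext w\<close> along
    \<open>flow t\<close> is itself a unit test on \<open>Ytil\<close>, so duality for
    \<open>Rhat\<close> applies under the time integral.\<close>
  also have "\<dots> = (\<integral>t. (\<integral>p. ?Y (t, p) \<partial>mutil M) \<partial>times)"
    using R(2)[OF unit_test_Linf[OF flow_test(2)[OF w]]]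
    by (intro Bochner_Integration.integral_cong[OF refl, of times]) simp
  \<comment> \<open>The shift in time depends on \<open>p\<close>, so the time integral has to
    become the inner one.\<close>
  also have "\<dots> = (\<integral>p. (\<integral>t. ?Y (t, p) \<partial>times) \<partial>mutil M)"
    using TM.integral_fst'[OF int_Y] TM.integral_snd[of "\<lambda>t p. ?Y (t, p)"] int_Y by (simp add: case_prod_unfold)
  also have "\<dots> = (\<integral>p. (\<integral>t. ?Z (t, p) \<partial>times) \<partial>mutil M)"
    using renewal_time_integral[OF w]
    by (intro Bochner_Integration.integral_cong[OF refl, of "mutil M"]) (simp add: space_mutil cong: if_cong)
  also have "\<dots> = (\<integral>q. ?Z q \<partial>(times \<Otimes>\<^sub>M mutil M))"
    using TM.integral_snd[of "\<lambda>t p. ?Z (t, p)"] int_Z by (simp add: case_prod_unfold cong: if_cong)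
  \<comment> \<open>Times after \<open>\<phi>(p)\<close> are all times minus those cut off in
    \<open>Uop\<close>.\<close>
  also have "\<dots> = (\<integral>q. ?V q - ?V' q \<partial>(times \<Otimes>\<^sub>M mutil M))"
    by (intro Bochner_Integration.integral_cong refl) auto
  also have "\<dots> = (\<integral>p. That M F \<phi> s v p * w p \<partial>mutil M) - (\<integral>p. Uhat M F \<phi> s v p * w p \<partial>mutil M)"
    using int_V int_V' by (simp only: T(2)[OF w] U(2)[OF w] Bochner_Integration.integral_diff)
  also have "\<dots> = (\<integral>p. (That M F \<phi> s v p - Uhat M F \<phi> s v p) * w p \<partial>mutil M)"
    using integrable_mult_Linf[OF T(1) unit_test_Linf[OF w]] integrable_mult_Linf[OF U(1) unit_test_Linf[OF w]]
    by (simp add: left_diff_distrib)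
  finally show "(\<integral>p. That M F \<phi> s (Rhat M F \<phi> s v) p * w p \<partial>mutil M)
    = (\<integral>p. (That M F \<phi> s v p - Uhat M F \<phi> s v p) * w p \<partial>mutil M)" .
qed

end

theorem theorem3p3:
  fixes \<mu> :: "'a measure" and \<alpha> :: "'a set set" and F :: "'a \<Rightarrow> 'a" and \<phi> :: "'a \<Rightarrow> real"
    and \<theta> \<theta>\<^sub>0 C\<^sub>2 :: real
  assumes "lebesgue_prob_space \<mu>"
    and "0 < \<theta>" "\<theta> < 1"
    and "full_branch_gibbs_markov \<mu> \<alpha> F \<theta>"
    and "\<phi> \<in> borel_measurable \<mu>"
    and "\<forall>y\<in>space \<mu>. 0 < \<phi> y"
    and "2 < (INF y\<in>space \<mu>. \<phi> y)"
    and "0 < \<theta>\<^sub>0" "\<theta>\<^sub>0 < 1" "0 < C\<^sub>2"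
    and "\<forall>a\<in>\<alpha>. \<forall>y\<in>a. \<forall>y'\<in>a.
           \<bar>\<phi> y - \<phi> y'\<bar> \<le> C\<^sub>2 * (INF z\<in>a. \<phi> z) * d_sep \<alpha> F \<theta>\<^sub>0 y y'"
  shows "\<forall>s::complex. Re s > 0 \<longrightarrow>
           (\<forall>v. integrable (mutil \<mu>) v \<longrightarrow>
             (AE p in mutil \<mu>. That \<mu> F \<phi> s (Rhat \<mu> F \<phi> s v) p
                = That \<mu> F \<phi> s v p - Uhat \<mu> F \<phi> s v p))"
proof -
  interpret prob_space \<mu> using assms(1) by (simp add: lebesgue_prob_space_def)
  \<comment> \<open>A real-valued \<open>INF\<close> is guaranteed to be a lower bound only for
    families bounded below, which positivity of the roof ensures.\<close>
  have "bdd_below (\<phi> ` space \<mu>)" using assms(6) by (auto intro!: bdd_belowI[of _ 0] less_imp_le)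
  then have "2 < \<phi> y" if "y \<in> space \<mu>" for y
    using assms(7) cINF_lower[of \<phi> "space \<mu>" y] that by (simp add: less_le_trans)
  moreover have "F \<in> measurable \<mu> \<mu>" "distr \<mu> \<mu> F = \<mu>"
    using assms(4) by (auto simp: full_branch_gibbs_markov_def measure_preserving_map_def)
  ultimately interpret suspension \<mu> F \<phi>
    using assms(5) by unfold_locales auto
  show ?thesis using renewal_equation by blast
qed

end
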